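(* Let $\mathbb{G}$ be a homogeneous Lie group of homogeneous dimension $Q$ and $|\cdot|$ any homogeneous quasi-norm. Let $1<p,q<\infty$, $0<r<\infty$ with $p+q\ge r$, $\delta\in[0,1]\cap\left[\frac{r-q}{r},\frac{p}{r}\right]$, and $\alpha,b,c\in\mathbb{R}$ with $\frac{\delta r}{p}+\frac{(1-\delta)r}{q}=1$ and $c=-\delta+b(1-\delta)$. Then for every complex-valued $f\in C_0^\infty(\mathbb{G}\setminus\{0\})$, $$\left|\frac{Q-\alpha}{p}\right|^\delta\left\||x|^{\alpha c/p}f\right\|_{L^r(\mathbb{G})}\le\left[\left\|\frac{\mathcal{R}_{|x|}f}{|x|^{\alpha/p-1}}\right\|_{L^p(\mathbb{G})}^p-\int_{\mathbb{G}}C_p\!\left(\frac{\mathcal{R}_{|x|}f}{|x|^{\alpha/p-1}},\frac{\mathcal{R}_{|x|}f}{|x|^{\alpha/p-1}}+\frac{Q-\alpha}{p}\frac{f}{|x|^{\alpha/p}}\right)dx\right]^{\delta/p}\left\||x|^{\alpha b/p}f\right\|_{L^q(\mathbb{G})}^{1-\delta}.$$ Moreover, when $\alpha\ne Q$, the constant $\left|\frac{Q-\alpha}{p}\right|^\delta$ is sharp for any homogeneous quasi-norm in the case $q=p$ with $b=-1$, and in the cases $\delta\in\{0,1\}$.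
   Context: A homogeneous Lie group is a connected simply connected (nilpotent) Lie group $\mathbb{G}$, identified with $\mathbb{R}^n$, whose Lie algebra carries dilations $D_\lambda=\exp(A\ln\lambda)$ with $A$ diagonalisable with positive eigenvalues and each $D_\lambda$ a Lie algebra automorphism, inducing dilations $x\mapsto\lambda x$ on $\mathbb{G}$; $Q=\operatorname{Tr}A$ and Haar (Lebesgue) measure satisfies $\int f(\lambda x)dx=\lambda^{-Q}\int fdx$. A homogeneous quasi-norm is a continuous $|\cdot|:\mathbb{G}\to[0,\infty)$ with $|x^{-1}|=|x|$, $|\lambda x|=\lambda|x|$, $|x|=0$ iff $x=0$. The radial derivative is $\mathcal{R}_{|x|}f(x)=\frac{d}{dr}f(ry)$ at $r=|x|$, $y=x/|x|$. For complex $\xi,\eta$, $C_p(\xi,\eta):=|\xi|^p-|\xi-\eta|^p-p|\xi-\eta|^{p-2}\operatorname{Re}((\xi-\eta)\overline{\eta})$ (last term $0$ when $\xi=\eta$). Sharp means the constant cannot be replaced by a larger one. *)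

theory Defs
  imports "HOL-Analysis.Analysis"
begin

definition partial_dir :: "'m::finite \<Rightarrow> (real^'m \<Rightarrow> 'b::real_normed_vector) \<Rightarrow> real^'m \<Rightarrow> 'b" where
  "partial_dir i f x = vector_derivative (\<lambda>t. f (x + t *\<^sub>R axis i 1)) (at 0)"

definition smooth_map :: "(real^'m::finite \<Rightarrow> 'b::real_normed_vector) \<Rightarrow> bool" where
  "smooth_map f \<longleftrightarrow>
     (\<forall>is. continuous_on UNIV (foldr partial_dir is f) \<and>
           (\<forall>i x. (\<lambda>t. foldr partial_dir is f (x + t *\<^sub>R axis i 1)) differentiable (at 0)))"

section \<open>Homogeneous Lie groups on R^n (exponential coordinates)\<close>

text \<open>Dilation D_lambda = exp(A ln lambda) with A = P diag(w) P^-1 diagonalisable,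
  positive eigenvalues w.\<close>
definition dilation :: "real^'n^'n \<Rightarrow> real^'n \<Rightarrow> real \<Rightarrow> real^'n \<Rightarrow> real^'n" where
  "dilation P w lam x = P *v (\<chi> i. (lam powr (w$i)) * ((matrix_inv P *v x)$i))"

definition homogeneous_dim :: "real^'n \<Rightarrow> real" where
  "homogeneous_dim w = (\<Sum>i\<in>UNIV. w$i)"

definition homogeneous_Lie_group ::
  "(real^'n \<Rightarrow> real^'n \<Rightarrow> real^'n) \<Rightarrow> (real^'n \<Rightarrow> real^'n) \<Rightarrow> real^'n^'n \<Rightarrow> real^'n \<Rightarrow> bool" where
  "homogeneous_Lie_group mul ginv P w \<longleftrightarrow>
     (\<forall>x y z. mul (mul x y) z = mul x (mul y z)) \<and>
     (\<forall>x. mul 0 x = x \<and> mul x 0 = x) \<and>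
     (\<forall>x. mul (ginv x) x = 0 \<and> mul x (ginv x) = 0) \<and>
     smooth_map (\<lambda>z::real^('n + 'n). mul (\<chi> i. z $ Inl i) (\<chi> i. z $ Inr i)) \<and>
     smooth_map ginv \<and>
     (\<forall>x s t. mul (s *\<^sub>R x) (t *\<^sub>R x) = (s + t) *\<^sub>R x) \<and>
     invertible P \<and> (\<forall>i. w$i > 0) \<and>
     (\<forall>lam>0. \<forall>x y. dilation P w lam (mul x y) = mul (dilation P w lam x) (dilation P w lam y)) \<and>
     (\<forall>a. distr lborel lborel (mul a) = lborel)"

definition hom_quasi_norm ::
  "(real^'n \<Rightarrow> real^'n) \<Rightarrow> real^'n^'n \<Rightarrow> real^'n \<Rightarrow> (real^'n \<Rightarrow> real) \<Rightarrow> bool" where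
  "hom_quasi_norm ginv P w N \<longleftrightarrow>
     continuous_on UNIV N \<and> (\<forall>x. N x \<ge> 0) \<and> (\<forall>x. N (ginv x) = N x) \<and>
     (\<forall>lam>0. \<forall>x. N (dilation P w lam x) = lam * N x) \<and> (\<forall>x. N x = 0 \<longleftrightarrow> x = 0)"

definition test_fun :: "(real^'n \<Rightarrow> complex) \<Rightarrow> bool" where
  "test_fun f \<longleftrightarrow> smooth_map f \<and> (\<exists>K. compact K \<and> 0 \<notin> K \<and> (\<forall>x. x \<notin> K \<longrightarrow> f x = 0))"

definition radial_deriv ::
  "real^'n^'n \<Rightarrow> real^'n \<Rightarrow> (real^'n \<Rightarrow> real) \<Rightarrow> (real^'n \<Rightarrow> complex) \<Rightarrow> real^'n \<Rightarrow> complex" where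
  "radial_deriv P w N f x =
     vector_derivative (\<lambda>s. f (dilation P w s (dilation P w (1 / N x) x))) (at (N x))"

definition Lnorm :: "real \<Rightarrow> (real^'n \<Rightarrow> complex) \<Rightarrow> real" where
  "Lnorm r g = (\<integral>x. norm (g x) powr r \<partial>lborel) powr (1 / r)"

definition Cp :: "real \<Rightarrow> complex \<Rightarrow> complex \<Rightarrow> real" where
  "Cp p \<xi> \<eta> = (if \<xi> = \<eta> then norm \<xi> powr p
     else norm \<xi> powr p - norm (\<xi> - \<eta>) powr p - p * norm (\<xi> - \<eta>) powr (p - 2) * Re ((\<xi> - \<eta>) * cnj \<eta>))"

text \<open>Real power with the convention 0^0 = 1 (for nonnegative bases).\<close>
definition rpow0 :: "real \<Rightarrow> real \<Rightarrow> real" where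
  "rpow0 x a = (if a = 0 then 1 else x powr a)"

definition hardy_bracket ::
  "real^'n^'n \<Rightarrow> real^'n \<Rightarrow> (real^'n \<Rightarrow> real) \<Rightarrow> real \<Rightarrow> real \<Rightarrow> (real^'n \<Rightarrow> complex) \<Rightarrow> real" where
  "hardy_bracket P w N p \<alpha> f =
     (let Q = homogeneous_dim w;
          u = (\<lambda>x. radial_deriv P w N f x / complex_of_real (N x powr (\<alpha> / p - 1)));
          v = (\<lambda>x. u x + complex_of_real ((Q - \<alpha>) / p) * (f x / complex_of_real (N x powr (\<alpha> / p))))
      in (Lnorm p u) powr p - (\<integral>x. Cp p (u x) (v x) \<partial>lborel))"

definition CKN_ineq ::
  "real^'n^'n \<Rightarrow> real^'n \<Rightarrow> (real^'n \<Rightarrow> real) \<Rightarrow> real \<Rightarrow> real \<Rightarrow> real \<Rightarrow> real \<Rightarrow> real \<Rightarrow> real \<Rightarrow> real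
    \<Rightarrow> real \<Rightarrow> (real^'n \<Rightarrow> complex) \<Rightarrow> bool" where
  "CKN_ineq P w N p q r \<delta> \<alpha> b c C f \<longleftrightarrow>
     C * Lnorm r (\<lambda>x. complex_of_real (N x powr (\<alpha> * c / p)) * f x)
       \<le> rpow0 (hardy_bracket P w N p \<alpha> f) (\<delta> / p) *
         rpow0 (Lnorm q (\<lambda>x. complex_of_real (N x powr (\<alpha> * b / p)) * f x)) (1 - \<delta>)"

end

theory Submission
  imports Defs "HOL-Computational_Algebra.Polynomial"
begin

text \<open>Put \<open>\<beta> = (Q - \<alpha>) / p\<close> and let \<open>E f\<close> be the derivative of \<open>s \<mapsto> f (D\<^sub>s x)\<close> at \<open>s = 1\<close>, so that
  the radial derivative is \<open>E f / N\<close>. Expanding \<open>C\<^sub>p\<close> and using the scaling identity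
  \<open>\<integral> N\<^sup>-\<^sup>\<alpha> E(|f|\<^sup>p) = (\<alpha> - Q) \<integral> N\<^sup>-\<^sup>\<alpha> |f|\<^sup>p\<close>, the bracket equals \<open>|\<beta>|\<^sup>p \<integral> N\<^sup>-\<^sup>\<alpha> |f|\<^sup>p\<close> exactly.
  The inequality is then Hoelder's inequality, and in the three cases of the sharpness claim
  Hoelder degenerates to an equality for every \<open>f\<close>, so any nonzero test function is extremal.\<close>

section \<open>Differentiability\<close>

text \<open>The expansion works because \<open>\<xi> - \<eta>\<close> is \<open>- \<beta> g\<close>
  with \<open>g = N^(-\<alpha>/p) f\<close>: pointwise, \<open>C_p\<close> is
  \<open>|\<xi>|^p\<close> minus a combination \<open>R\<close> of
  \<open>N^(-\<alpha>) |f|^p\<close> and \<open>N^(-\<alpha>) E(|f|^p)\<close>. So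
  \<open>|\<xi>|^p\<close> cancels in the bracket, which becomes the integral of \<open>R\<close>.
  Three obstacles shape the rest. \<open>smooth_map\<close> speaks only of iterated partial
  derivatives, so total differentiability must be proved before the chain rule can be used along
  dilation orbits. For \<open>p < 2\<close> the factor \<open>|f|^(p-2)\<close> in
  \<open>E(|f|^p)\<close> is singular at the zeros of \<open>f\<close>, yet the whole expression is
  at most \<open>p |f|^(p-1) |E f|\<close>, which \<open>p > 1\<close> keeps bounded. Finally, the
  extremal must be a concrete smooth function with positive norm; it is built from
  \<open>exp(-1/t)\<close>.\<close>

lemma smooth_map_partial:
  assumes "smooth_map f"
  shows "((\<lambda>t. f (x + t *\<^sub>R axis i 1)) has_vector_derivative partial_dir i f (x + s *\<^sub>R axis i 1)) (at s)"
proof -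
  \<comment> \<open>\<open>smooth_map\<close> gives differentiability at parameter 0 only; moving
    the base point along the axis reaches every parameter \<open>s\<close>.\<close>
  have "(\<lambda>t. f ((x + s *\<^sub>R axis i 1) + t *\<^sub>R axis i 1)) differentiable (at 0)"
    using assms unfolding smooth_map_def by (metis foldr.simps(1) id_apply)
  then have "((\<lambda>t. f ((x + s *\<^sub>R axis i 1) + t *\<^sub>R axis i 1)) has_vector_derivative
      partial_dir i f (x + s *\<^sub>R axis i 1)) (at 0)"
    unfolding partial_dir_def by (simp add: vector_derivative_works)
  then have 0: "((\<lambda>t. f ((x + s *\<^sub>R axis i 1) + t *\<^sub>R axis i 1)) has_vector_derivative
      partial_dir i f (x + s *\<^sub>R axis i 1)) (at (s - s))"
    by simp
  have "((\<lambda>t. t - s) has_vector_derivative 1) (at s)"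
    by (auto intro!: derivative_eq_intros)
  from vector_diff_chain_at[OF this, of "\<lambda>t. f ((x + s *\<^sub>R axis i 1) + t *\<^sub>R axis i 1)"]
  have "(((\<lambda>t. f ((x + s *\<^sub>R axis i 1) + t *\<^sub>R axis i 1)) \<circ> (\<lambda>t. t - s)) has_vector_derivative
      1 *\<^sub>R partial_dir i f (x + s *\<^sub>R axis i 1)) (at s)"
    using 0 by blast
  then show ?thesis
    by (simp add: o_def algebra_simps)
qed

lemma smooth_map_continuous: "smooth_map f \<Longrightarrow> continuous_on UNIV f"
  unfolding smooth_map_def by (metis foldr.simps(1) id_apply)

lemma smooth_map_continuous_partial: "smooth_map f \<Longrightarrow> continuous_on UNIV (partial_dir i f)"
  unfolding smooth_map_def by (metis foldr.simps comp_apply id_apply)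

text \<open>The classical argument that continuous partial derivatives yield a total derivative: the
  coordinates in \<open>S\<close> are moved one at a time, and each move adds an error of at most
  \<open>e * norm h\<close>.\<close>

lemma telescoping_axes:
  fixes f :: "real^'m \<Rightarrow> 'b::real_normed_vector"
    and e :: real
  assumes f: "smooth_map f" and "e > 0"
  shows "\<exists>d>0. \<forall>h. norm h < d \<longrightarrow>
    norm (f (x + (\<Sum>i\<in>S. h $ i *\<^sub>R axis i 1)) - f x - (\<Sum>i\<in>S. h $ i *\<^sub>R partial_dir i f x))
      \<le> card S * e * norm h"
proof (induction S rule: infinite_finite_induct)
  case (insert j S)
  then obtain d1 where d1: "d1 > 0" "\<And>h. norm h < d1 \<Longrightarrow>
    norm (f (x + (\<Sum>i\<in>S. h $ i *\<^sub>R axis i 1)) - f x - (\<Sum>i\<in>S. h $ i *\<^sub>R partial_dir i f x))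
      \<le> card S * e * norm h" by blast
  have "continuous (at x) (partial_dir j f)"
    using smooth_map_continuous_partial[OF f] by (simp add: continuous_on_eq_continuous_at)
  then obtain d2 where d2: "d2 > 0"
    "\<And>y. dist y x < d2 \<Longrightarrow> dist (partial_dir j f y) (partial_dir j f x) < e"
    using \<open>e > 0\<close> unfolding continuous_at_eps_delta by blast
  \<comment> \<open>While coordinate \<open>j\<close> moves, the distance to \<open>x\<close> is at
    most \<open>CARD('m) * norm h\<close> from the coordinates in \<open>S\<close> plus
    \<open>norm h\<close> from the current one.\<close>
  define d where "d = min d1 (d2 / (CARD('m) + 1))"
  have "norm (f (x + (\<Sum>i\<in>insert j S. h $ i *\<^sub>R axis i 1)) - f x
      - (\<Sum>i\<in>insert j S. h $ i *\<^sub>R partial_dir i f x)) \<le> card (insert j S) * e * norm h"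
    if h: "norm h < d" for h
  proof -
    define y where "y = x + (\<Sum>i\<in>S. h $ i *\<^sub>R axis i 1)"
    have hi: "\<bar>h $ i\<bar> \<le> norm h" for i
      by (rule component_le_norm_cart)
    have "norm (\<Sum>i\<in>S. h $ i *\<^sub>R axis i (1::real)) \<le> card S * norm h"
      by (rule order.trans[OF norm_sum], rule sum_bounded_above) (use hi in simp)
    also have "\<dots> \<le> CARD('m) * norm h"
      by (intro mult_right_mono) (auto intro: card_mono)
    finally have sum_le: "norm (\<Sum>i\<in>S. h $ i *\<^sub>R axis i (1::real)) \<le> CARD('m) * norm h" .
    have "norm (y + t *\<^sub>R axis j 1 - x) \<le> (CARD('m) + 1) * norm h" if "\<bar>t\<bar> \<le> norm h" for t
    proof -
      have "y + t *\<^sub>R axis j 1 - x = (\<Sum>i\<in>S. h $ i *\<^sub>R axis i 1) + t *\<^sub>R axis j 1"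
        by (simp add: y_def)
      moreover have "norm (t *\<^sub>R axis j (1::real)) \<le> norm h"
        using that by simp
      ultimately show ?thesis
        using norm_triangle_le[OF add_mono[OF sum_le]] by (simp only: of_nat_add of_nat_1 distrib_right mult_1)
    qed
    moreover have "(CARD('m) + 1) * norm h < d2"
      using h unfolding d_def by (simp add: field_simps)
    ultimately have near: "norm (partial_dir j f (y + t *\<^sub>R axis j 1) - partial_dir j f x) \<le> e"
      if "\<bar>t\<bar> \<le> norm h" for t
      using that d2(2)[of "y + t *\<^sub>R axis j 1"] by (force simp: dist_norm)
    have "norm (f (y + (h $ j) *\<^sub>R axis j 1) - f (y + 0 *\<^sub>R axis j 1) - (h $ j - 0) *\<^sub>R partial_dir j f x)
        \<le> norm (h $ j - 0) * e"
    proof -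
      \<comment> \<open>With the linear part subtracted, the derivative is a difference of two
        values of \<open>partial_dir j f\<close>, hence at most \<open>e\<close> in norm.\<close>
      define g where "g = (\<lambda>t. f (y + t *\<^sub>R axis j 1) - t *\<^sub>R partial_dir j f x)"
      have "norm (g (h $ j) - g 0) \<le> e * norm (h $ j - 0)"
      proof (rule differentiable_bound[where S="{t. \<bar>t\<bar> \<le> norm h}"])
        show "convex {t. \<bar>t\<bar> \<le> norm h}"
          using convex_cball[of "0::real" "norm h"] by (simp add: cball_def)
        show "(g has_derivative (\<lambda>s. s *\<^sub>R (partial_dir j f (y + t *\<^sub>R axis j 1) - partial_dir j f x)))
            (at t within {t. \<bar>t\<bar> \<le> norm h})" for t
          unfolding g_def has_vector_derivative_def[symmetric]
          by (auto intro!: derivative_eq_intros has_vector_derivative_at_within[OF smooth_map_partial[OF f]])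
        show "onorm (\<lambda>s. s *\<^sub>R (partial_dir j f (y + t *\<^sub>R axis j 1) - partial_dir j f x)) \<le> e"
          if "t \<in> {t. \<bar>t\<bar> \<le> norm h}" for t
          using near[of t] that by (intro onorm_le) (simp add: mult.commute[of e] mult_left_mono)
      qed (use hi in auto)
      then show ?thesis by (simp add: g_def algebra_simps)
    qed
    also have "norm (h $ j - 0) * e \<le> norm h * e"
      using hi[of j] \<open>e > 0\<close> by simp
    finally have 1: "norm (f (y + (h $ j) *\<^sub>R axis j 1) - f y - (h $ j) *\<^sub>R partial_dir j f x) \<le> norm h * e"
      by simp
    have 2: "norm (f y - f x - (\<Sum>i\<in>S. h $ i *\<^sub>R partial_dir i f x)) \<le> card S * e * norm h"
      unfolding y_def using h d1(2) by (simp add: d_def)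
    have eq: "f (x + (\<Sum>i\<in>insert j S. h $ i *\<^sub>R axis i 1)) - f x
      - (\<Sum>i\<in>insert j S. h $ i *\<^sub>R partial_dir i f x) =
      (f (y + (h $ j) *\<^sub>R axis j 1) - f y - (h $ j) *\<^sub>R partial_dir j f x) +
      (f y - f x - (\<Sum>i\<in>S. h $ i *\<^sub>R partial_dir i f x))"
      using insert by (simp add: y_def algebra_simps)
    show ?thesis unfolding eq
      using norm_triangle_le[OF add_mono[OF 1 2]] insert by (simp add: algebra_simps)
  qed
  moreover have "d > 0" using d1 d2 by (simp add: d_def)
  ultimately show ?case by blast
qed (use \<open>e > 0\<close> in \<open>auto intro!: exI[of _ 1]\<close>)

lemma smooth_map_has_derivative:
  fixes f :: "real^'m \<Rightarrow> 'b::real_normed_vector"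
  assumes "smooth_map f"
  shows "(f has_derivative (\<lambda>h. \<Sum>i\<in>UNIV. h $ i *\<^sub>R partial_dir i f x)) (at x)"
proof (rule has_derivative_at_alt[THEN iffD2], intro conjI allI impI)
  show "bounded_linear (\<lambda>h. \<Sum>i\<in>UNIV. h $ i *\<^sub>R partial_dir i f x)"
    by (intro bounded_linear_sum bounded_linear_scaleR_left bounded_linear_compose[OF bounded_linear_scaleR_left] bounded_linear_vec_nth)
  fix e :: real assume "e > 0"
  \<comment> \<open>Compensates the factor \<open>card S\<close> of \<open>telescoping_axes\<close>
    at \<open>S = UNIV\<close>.\<close>
  then have "e / CARD('m) > 0" by simp
  from telescoping_axes[OF assms this, of x UNIV] obtain d where d: "d > 0" "\<And>h. norm h < d \<Longrightarrow>
    norm (f (x + (\<Sum>i\<in>UNIV. h $ i *\<^sub>R axis i 1)) - f x - (\<Sum>i\<in>UNIV. h $ i *\<^sub>R partial_dir i f x))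
      \<le> e * norm h" by auto
  have sum_axis: "(\<Sum>i\<in>UNIV. h $ i *\<^sub>R axis i 1) = h" for h :: "real^'m"
    using basis_expansion[of h] by (simp add: scalar_mult_eq_scaleR)
  show "\<exists>d>0. \<forall>y. norm (y - x) < d \<longrightarrow>
      norm (f y - f x - (\<Sum>i\<in>UNIV. (y - x) $ i *\<^sub>R partial_dir i f x)) \<le> e * norm (y - x)"
  proof (intro exI conjI allI impI)
    show "norm (f y - f x - (\<Sum>i\<in>UNIV. (y - x) $ i *\<^sub>R partial_dir i f x)) \<le> e * norm (y - x)"
      if "norm (y - x) < d" for y
      using d(2)[OF that] by (simp only: sum_axis) simp
  qed (rule d)
qed

text \<open>Away from zeros this is the chain rule. At a zero, \<open>norm (\<gamma> s)\<close> is
  at most \<open>M * \<bar>s - t\<bar>\<close>, so the difference quotient is of order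
  \<open>\<bar>s - t\<bar> powr (p - 1)\<close> and tends to 0, which is also the value of the
  formula there, even for \<open>p < 2\<close>.\<close>

lemma norm_powr_has_real_derivative:
  fixes \<gamma> :: "real \<Rightarrow> complex"
  assumes g: "(\<gamma> has_vector_derivative d) (at t)" and p: "1 < p"
  shows "((\<lambda>s. norm (\<gamma> s) powr p) has_real_derivative
           p * norm (\<gamma> t) powr (p - 2) * Re (\<gamma> t * cnj d)) (at t)"
proof (cases "\<gamma> t = 0")
  case False
  have n: "((\<lambda>s. norm (\<gamma> s)) has_real_derivative (\<gamma> t \<bullet> d) / norm (\<gamma> t)) (at t)"
    unfolding has_field_derivative_def
    by (rule has_derivative_eq_rhs[OF has_derivative_compose[OF g[unfolded has_vector_derivative_def] has_derivative_norm[OF False]]])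
       (auto simp: fun_eq_iff sgn_div_norm inner_commute field_simps)
  have "norm (\<gamma> t) powr (p - 1) = norm (\<gamma> t) powr (p - 2) * norm (\<gamma> t)"
    using False powr_add[of "norm (\<gamma> t)" "p - 2" 1] by simp
  then show ?thesis
    using DERIV_chain2[OF has_real_derivative_powr[of "norm (\<gamma> t)" p] n] False
    by (simp add: inner_complex_def mult.assoc)
next
  case True
  define M where "M = 1 + norm d"
  obtain e where e: "e > 0" "\<And>s. norm (s - t) < e \<Longrightarrow> norm (\<gamma> s - \<gamma> t - (s - t) *\<^sub>R d) \<le> 1 * norm (s - t)"
    using g unfolding has_vector_derivative_def has_derivative_at_alt by (metis zero_less_one)
  have near: "norm (\<gamma> s) \<le> M * \<bar>s - t\<bar>" if "norm (s - t) < e" for s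
    using e(2)[OF that] norm_triangle_ineq[of "\<gamma> s - (s - t) *\<^sub>R d" "(s - t) *\<^sub>R d"] True
    by (simp add: M_def distrib_right mult.commute[of "norm d"])
  have "((\<lambda>s. norm (\<gamma> s) powr p / (s - t)) \<longlongrightarrow> 0) (at t)"
  proof (rule Lim_null_comparison)
    have "norm (norm (\<gamma> s) powr p / (s - t)) \<le> M powr p * \<bar>s - t\<bar> powr (p - 1)"
      if "norm (s - t) < e" "s \<noteq> t" for s
    proof -
      have "norm (\<gamma> s) powr p \<le> (M * \<bar>s - t\<bar>) powr p"
        using near[OF that(1)] p by (intro powr_mono2) auto
      also have "\<dots> = M powr p * \<bar>s - t\<bar> powr (p - 1) * \<bar>s - t\<bar>"
        using that powr_add[of "\<bar>s - t\<bar>" "p - 1" 1] by (simp add: powr_mult M_def)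
      finally show ?thesis using that by (simp add: field_simps)
    qed
    then show "\<forall>\<^sub>F s in at t. norm (norm (\<gamma> s) powr p / (s - t)) \<le> M powr p * \<bar>s - t\<bar> powr (p - 1)"
      using e(1) unfolding eventually_at by (auto simp: dist_norm)
    have "((\<lambda>s. \<bar>s - t\<bar> powr (p - 1)) \<longlongrightarrow> 0 powr (p - 1)) (at t)"
      using p by (intro tendsto_powr') (auto intro!: tendsto_eq_intros)
    then show "((\<lambda>s. M powr p * \<bar>s - t\<bar> powr (p - 1)) \<longlongrightarrow> 0) (at t)"
      by (auto intro: tendsto_mult_right_zero)
  qed
  then show ?thesis using True by (simp add: has_field_derivative_iff)
qed

section \<open>A nonzero test function\<close>

text \<open>Every derivative of \<open>exp(-1/t)\<close> is a polynomial in \<open>1/t\<close> times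
  \<open>exp(-1/t)\<close>; admitting all polynomials makes the family closed under
  differentiation.\<close>

definition flat :: "real poly \<Rightarrow> real \<Rightarrow> real" where
  "flat q t = (if 0 < t then poly q (1 / t) * exp (- (1 / t)) else 0)"

lemma poly_times_exp_minus_tendsto_0:
  "((\<lambda>s::real. poly q s * exp (- s)) \<longlongrightarrow> 0) at_top"
proof -
  have "((\<lambda>s. \<Sum>i\<le>degree q. coeff q i * (s ^ i / exp s)) \<longlongrightarrow> (\<Sum>i\<le>degree q. coeff q i * 0)) at_top"
    by (intro tendsto_sum tendsto_mult tendsto_const tendsto_power_div_exp_0)
  then show ?thesis
    by (simp add: poly_altdef sum_distrib_right exp_minus divide_inverse mult.assoc)
qed

lemma flat_has_real_derivative:
  "(flat q has_real_derivative flat (monom 1 2 * (q - pderiv q)) t) (at t)"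
proof -
  consider "t < 0" | "t = 0" | "0 < t" by linarith
  then show ?thesis
  proof cases
    case 1
    have "((\<lambda>_. 0) has_real_derivative 0) (at t)" by simp
    then have "(flat q has_real_derivative 0) (at t)"
      by (rule has_field_derivative_transform_within_open[of _ _ _ "{..<0}"]) (use 1 in \<open>auto simp: flat_def\<close>)
    then show ?thesis using 1 by (simp add: flat_def)
  next
    case 2
    have "((\<lambda>s. flat q s / s) \<longlongrightarrow> 0) (at_right 0)"
    proof (rule Lim_transform_eventually)
      \<comment> \<open>Dividing \<open>flat q s\<close> by \<open>s\<close> multiplies the
        polynomial by its variable, which is \<open>pCons 0 q\<close>.\<close>
      show "((\<lambda>s. poly (pCons 0 q) (inverse s) * exp (- inverse s)) \<longlongrightarrow> 0) (at_right 0)"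
        using poly_times_exp_minus_tendsto_0 filterlim_inverse_at_top_right by (rule filterlim_compose)
      show "\<forall>\<^sub>F s in at_right 0. poly (pCons 0 q) (inverse s) * exp (- inverse s) = flat q s / s"
        unfolding eventually_at_right_field by (rule exI[of _ 1]) (auto simp: flat_def field_simps)
    qed
    moreover have "((\<lambda>s. flat q s / s) \<longlongrightarrow> 0) (at_left 0)"
      by (rule Lim_transform_eventually[OF tendsto_const])
         (auto simp: eventually_at_left_field flat_def intro!: exI[of _ "-1"])
    ultimately have "((\<lambda>s. flat q s / s) \<longlongrightarrow> 0) (at 0)"
      by (simp add: filterlim_split_at)
    then show ?thesis using 2 by (simp add: has_field_derivative_iff flat_def)
  next
    case 3
    have "((\<lambda>t. poly q (1 / t) * exp (- (1 / t))) has_real_derivative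
        flat (monom 1 2 * (q - pderiv q)) t) (at t)"
      using 3 by (auto intro!: derivative_eq_intros DERIV_chain2[OF poly_DERIV]
        simp: flat_def poly_monom field_simps power2_eq_square)
    then show ?thesis
      by (rule has_field_derivative_transform_within_open[of _ _ _ "{0<..}"]) (use 3 in \<open>auto simp: flat_def\<close>)
  qed
qed

text \<open>Smoothness quantifies over all lists of directions. In a class closed under partial
  derivatives, induction on the list keeps every iterated derivative inside, so only continuity of
  the members remains.\<close>

lemma smooth_mapI_closed_class:
  assumes "f \<in> T"
    and cont: "\<And>g. g \<in> T \<Longrightarrow> continuous_on UNIV g"
    and closed: "\<And>g i. g \<in> T \<Longrightarrow>
      \<exists>g'\<in>T. \<forall>x. ((\<lambda>t. g (x + t *\<^sub>R axis i 1)) has_vector_derivative g' x) (at 0)"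
  shows "smooth_map f"
proof -
  have "foldr partial_dir is f \<in> T" for "is"
  proof (induction "is")
    case (Cons i js)
    then obtain g' where g': "g' \<in> T" "\<And>x. ((\<lambda>t. foldr partial_dir js f (x + t *\<^sub>R axis i 1)) has_vector_derivative g' x) (at 0)"
      using closed by blast
    then have "partial_dir i (foldr partial_dir js f) = g'"
      unfolding partial_dir_def by (auto intro: vector_derivative_at)
    then show ?case using g' by simp
  qed (use \<open>f \<in> T\<close> in simp)
  then show ?thesis
    unfolding smooth_map_def using cont closed
    by (meson differentiableI_vector)
qed

text \<open>A class for \<open>smooth_mapI_closed_class\<close> that contains products of
  one-variable cut-offs: \<open>add\<close> and \<open>mult\<close> make it stable under the product
  rule, \<open>one\<close> supplies the empty product, and the affine argument allows cut-offs from
  either side.\<close>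

inductive_set flat_algebra :: "(real^'m \<Rightarrow> complex) set" where
  flat: "(\<lambda>x. of_real (flat q (a * x $ j + c))) \<in> flat_algebra"
| one: "(\<lambda>x. 1) \<in> flat_algebra"
| add: "g \<in> flat_algebra \<Longrightarrow> h \<in> flat_algebra \<Longrightarrow> (\<lambda>x. g x + h x) \<in> flat_algebra"
| mult: "g \<in> flat_algebra \<Longrightarrow> h \<in> flat_algebra \<Longrightarrow> (\<lambda>x. g x * h x) \<in> flat_algebra"

lemma flat_0: "flat 0 t = 0"
  by (simp add: flat_def)

lemma flat_smult: "flat (smult a q) t = a * flat q t"
  by (simp add: flat_def)

lemma continuous_on_flat: "continuous_on S (flat q)"
  using flat_has_real_derivative by (meson DERIV_isCont continuous_at_imp_continuous_on)

lemma flat_algebra_continuous: "g \<in> flat_algebra \<Longrightarrow> continuous_on UNIV g"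
  by (induction rule: flat_algebra.induct)
     (auto intro!: continuous_intros continuous_on_compose2[OF continuous_on_flat[of UNIV]])

lemma flat_algebra_partial:
  "g \<in> flat_algebra \<Longrightarrow>
    \<exists>g'\<in>flat_algebra. \<forall>x. ((\<lambda>t. g (x + t *\<^sub>R axis i 1)) has_vector_derivative g' x) (at 0)"
proof (induction rule: flat_algebra.induct)
  case (flat q a j c)
  \<comment> \<open>The inner derivative: \<open>a\<close> if \<open>i = j\<close>, else 0. It is
    absorbed into the polynomial by \<open>smult\<close>.\<close>
  define e where "e = a * axis i (1::real) $ j"
  define q' where "q' = smult e (monom 1 2 * (q - pderiv q))"
  have "((\<lambda>t. of_real (flat q (a * (x + t *\<^sub>R axis i 1) $ j + c))) has_vector_derivative
      (of_real (flat q' (a * x $ j + c)) :: complex)) (at 0)" for x :: "real^'a"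
  proof -
    have "((\<lambda>t. flat q (e * t + (a * x $ j + c))) has_real_derivative flat q' (a * x $ j + c)) (at 0)"
    proof -
      have "((\<lambda>t. e * t + (a * x $ j + c)) has_real_derivative e) (at 0)"
        by (auto intro!: derivative_eq_intros)
      from DERIV_chain2[OF flat_has_real_derivative this, of q] show ?thesis
        by (simp add: q'_def flat_smult mult.commute[of e])
    qed
    then show ?thesis
      by (intro has_vector_derivative_of_real)
         (simp add: has_real_derivative_iff_has_vector_derivative e_def algebra_simps)
  qed
  then show ?case
    by (intro bexI[of _ "\<lambda>x. of_real (flat q' (a * x $ j + c))"]) (auto intro: flat_algebra.flat)
next
  case one
  \<comment> \<open>The zero function enters the class through the zero polynomial.\<close>
  have "(\<lambda>x. of_real (flat 0 (0 * x $ undefined + 0))) \<in> flat_algebra"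
    by (rule flat_algebra.flat)
  then show ?case by (auto simp: flat_0 intro!: bexI[of _ "\<lambda>_. 0"])
next
  case (add g h)
  then obtain g' h' where "g' \<in> flat_algebra" "h' \<in> flat_algebra"
    "\<And>x. ((\<lambda>t. g (x + t *\<^sub>R axis i 1)) has_vector_derivative g' x) (at 0)"
    "\<And>x. ((\<lambda>t. h (x + t *\<^sub>R axis i 1)) has_vector_derivative h' x) (at 0)" by blast
  then show ?case
    by (intro bexI[of _ "\<lambda>x. g' x + h' x"]) (auto intro: flat_algebra.add has_vector_derivative_add)
next
  case (mult g h)
  then obtain g' h' where *: "g' \<in> flat_algebra" "h' \<in> flat_algebra"
    "\<And>x. ((\<lambda>t. g (x + t *\<^sub>R axis i 1)) has_vector_derivative g' x) (at 0)"
    "\<And>x. ((\<lambda>t. h (x + t *\<^sub>R axis i 1)) has_vector_derivative h' x) (at 0)" by blast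
  have "((\<lambda>t. g (x + t *\<^sub>R axis i 1) * h (x + t *\<^sub>R axis i 1)) has_vector_derivative
      g x * h' x + g' x * h x) (at 0)" for x
    using has_vector_derivative_mult[OF *(3)[of x] *(4)[of x]] by simp
  then show ?case
    using * mult.hyps
    by (intro bexI[of _ "\<lambda>x. g x * h' x + g' x * h x"])
       (auto intro!: flat_algebra.add flat_algebra.mult)
qed

lemma flat_algebra_prod:
  "(\<And>j. j \<in> J \<Longrightarrow> g j \<in> flat_algebra) \<Longrightarrow> (\<lambda>x. \<Prod>j\<in>J. g j x) \<in> flat_algebra"
  by (induction J rule: infinite_finite_induct) (auto intro: flat_algebra.intros)

text \<open>In each coordinate the factors \<open>exp(-1/(t-1))\<close> and
  \<open>exp(-1/(2-t))\<close> are both nonzero exactly for \<open>1 < t < 2\<close>. The closed box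
  serves as the compact set and misses the origin.\<close>

lemma ex_test_fun_pos_on_box:
  obtains f :: "real^'m \<Rightarrow> complex"
  where "test_fun f" "\<And>x. x \<in> box 1 2 \<Longrightarrow> f x \<noteq> 0"
proof
  define f :: "real^'m \<Rightarrow> complex" where
    "f = (\<lambda>x. \<Prod>j\<in>UNIV. of_real (flat 1 (1 * x $ j + - 1)) * of_real (flat 1 (-1 * x $ j + 2)))"
  have "f \<in> flat_algebra"
    unfolding f_def by (intro flat_algebra_prod flat_algebra.mult flat_algebra.flat)
  then have "smooth_map f"
    by (rule smooth_mapI_closed_class) (auto intro: flat_algebra_continuous flat_algebra_partial)
  moreover have "f x = 0" if "x \<notin> cbox 1 2" for x
  proof -
    obtain j where "x $ j < 1 \<or> 2 < x $ j"
      using \<open>x \<notin> cbox 1 2\<close> by (auto simp: mem_box_cart not_le)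
    then show ?thesis
      unfolding f_def by (intro prod_zero) (auto simp: flat_def intro!: exI[of _ j])
  qed
  ultimately show "test_fun f"
    unfolding test_fun_def
    by (intro conjI exI[of _ "cbox 1 2"]) (auto simp: mem_box_cart)
  show "f x \<noteq> 0" if "x \<in> box 1 2" for x
    using that by (auto simp: f_def mem_box_cart flat_def)
qed

section \<open>Dilations\<close>

lemma nn_integral_lborel_shift:
  fixes h :: "'a::euclidean_space \<Rightarrow> ennreal"
  assumes [measurable]: "h \<in> borel_measurable borel"
  shows "(\<integral>\<^sup>+x. h (x + a) \<partial>lborel) = (\<integral>\<^sup>+x. h x \<partial>lborel)"
proof -
  have "(\<integral>\<^sup>+x. h x \<partial>lborel) = (\<integral>\<^sup>+x. h x \<partial>(distr lborel borel ((+) a)))"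
    by (simp add: lborel_distr_plus)
  then show ?thesis
    by (simp add: nn_integral_distr add.commute)
qed

text \<open>Uniqueness of translation-invariant measures, by Fubini. The factor need not be identified as a
  determinant: it cancels when a dilation is conjugated to a diagonal map.\<close>

lemma nn_integral_linear_surj:
  fixes L :: "'a::euclidean_space \<Rightarrow> 'a"
  assumes L: "linear L" "surj L"
  shows "\<exists>c. \<forall>h\<in>borel_measurable borel. (\<integral>\<^sup>+x. h (L x) \<partial>lborel) = c * (\<integral>\<^sup>+x. h x \<partial>lborel)"
proof (intro exI ballI)
  \<comment> \<open>A weight of integral one brings in a second variable \<open>y\<close>. Two
    exchanges of the order of integration, with translations in between, move \<open>L\<close> from
    \<open>h\<close> to \<open>k\<close>, and the integral of \<open>k (- L x)\<close> is the factor
    sought.\<close>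
  define k :: "'a \<Rightarrow> ennreal" where "k = indicator (cbox 0 One)"
  fix h :: "'a \<Rightarrow> ennreal" assume h[measurable]: "h \<in> borel_measurable borel"
  have [measurable]: "L \<in> borel_measurable borel"
    using L(1) by (intro borel_measurable_continuous_onI linear_continuous_on) (simp add: linear_linear)
  have [measurable]: "k \<in> borel_measurable borel"
    by (simp add: k_def)
  have k1: "(\<integral>\<^sup>+y. k y \<partial>lborel) = 1"
    by (simp add: k_def)
  have "(\<integral>\<^sup>+x. h (L x) \<partial>lborel) = (\<integral>\<^sup>+y. (\<integral>\<^sup>+x. h (L x) \<partial>lborel) * k y \<partial>lborel)"
    by (simp add: nn_integral_cmult k1)
  also have "\<dots> = (\<integral>\<^sup>+y. (\<integral>\<^sup>+x. h (L x + y) * k y \<partial>lborel) \<partial>lborel)"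
  proof (rule nn_integral_cong)
    fix y
    \<comment> \<open>Surjectivity turns a translation by \<open>y\<close> after \<open>L\<close>
      into a translation by \<open>z\<close> before \<open>L\<close>, which leaves the integral
      unchanged.\<close>
    obtain z where z: "y = L z" using L(2) by blast
    have "(\<integral>\<^sup>+x. h (L x) \<partial>lborel) = (\<integral>\<^sup>+x. h (L (x + z)) \<partial>lborel)"
      by (rule nn_integral_lborel_shift[symmetric]) measurable
    then show "(\<integral>\<^sup>+x. h (L x) \<partial>lborel) * k y = (\<integral>\<^sup>+x. h (L x + y) * k y \<partial>lborel)"
      by (simp add: z linear_add[OF L(1)] nn_integral_multc)
  qed
  also have "\<dots> = (\<integral>\<^sup>+x. (\<integral>\<^sup>+y. h (L x + y) * k y \<partial>lborel) \<partial>lborel)"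
    by (rule lborel_pair.Fubini') measurable
  also have "\<dots> = (\<integral>\<^sup>+x. (\<integral>\<^sup>+y. h y * k (y - L x) \<partial>lborel) \<partial>lborel)"
  proof (rule nn_integral_cong)
    fix x
    show "(\<integral>\<^sup>+y. h (L x + y) * k y \<partial>lborel) = (\<integral>\<^sup>+y. h y * k (y - L x) \<partial>lborel)"
      using nn_integral_lborel_shift[of "\<lambda>y. h y * k (y - L x)" "L x"] by (simp add: add.commute)
  qed
  also have "\<dots> = (\<integral>\<^sup>+y. (\<integral>\<^sup>+x. h y * k (y - L x) \<partial>lborel) \<partial>lborel)"
    by (rule lborel_pair.Fubini') measurable
  also have "\<dots> = (\<integral>\<^sup>+y. (\<integral>\<^sup>+x. k (- L x) \<partial>lborel) * h y \<partial>lborel)"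
  proof (rule nn_integral_cong)
    fix y
    obtain z where z: "y = L z" using L(2) by blast
    have "(\<integral>\<^sup>+x. k (- L x) \<partial>lborel) = (\<integral>\<^sup>+x. k (- L (x + - z)) \<partial>lborel)"
      by (rule nn_integral_lborel_shift[symmetric]) measurable
    also have "\<dots> = (\<integral>\<^sup>+x. k (y - L x) \<partial>lborel)"
      by (simp add: z linear_diff[OF L(1)])
    finally show "(\<integral>\<^sup>+x. h y * k (y - L x) \<partial>lborel) = (\<integral>\<^sup>+x. k (- L x) \<partial>lborel) * h y"
      by (simp add: nn_integral_cmult mult.commute)
  qed
  also have "\<dots> = (\<integral>\<^sup>+x. k (- L x) \<partial>lborel) * (\<integral>\<^sup>+y. h y \<partial>lborel)"
    by (rule nn_integral_cmult) measurable
  finally show "(\<integral>\<^sup>+x. h (L x) \<partial>lborel) = (\<integral>\<^sup>+x. k (- L x) \<partial>lborel) * (\<integral>\<^sup>+y. h y \<partial>lborel)" .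
qed

lemma nn_integral_diagonal:
  fixes w :: "real^'n" and h :: "real^'n \<Rightarrow> ennreal"
  assumes lam: "0 < lam" and h[measurable]: "h \<in> borel_measurable borel"
  shows "(\<integral>\<^sup>+x. h (\<chi> i. lam powr (w $ i) * x $ i) \<partial>lborel)
    = ennreal (lam powr (- homogeneous_dim w)) * (\<integral>\<^sup>+x. h x \<partial>lborel)"
proof -
  \<comment> \<open>The shape with \<open>0 +\<close> and a sum over \<open>Basis\<close> is that of
    \<open>lborel_affine_euclidean\<close>.\<close>
  define T where "T = (\<lambda>x::real^'n. 0 + (\<Sum>j\<in>Basis. (lam powr (w \<bullet> j) * (x \<bullet> j)) *\<^sub>R j))"
  have T: "T x = (\<chi> i. lam powr (w $ i) * x $ i)" for x
  proof (rule euclidean_eqI)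
    fix b :: "real^'n" assume b: "b \<in> Basis"
    then obtain i where "b = axis i 1" by (auto simp: Basis_vec_def)
    moreover have "T x \<bullet> b = lam powr (w \<bullet> b) * (x \<bullet> b)"
      using b by (simp add: T_def)
    ultimately show "T x \<bullet> b = (\<chi> i. lam powr (w $ i) * x $ i) \<bullet> b"
      by (simp add: inner_axis)
  qed
  have [measurable]: "T \<in> borel_measurable borel"
    by (simp add: T_def)
  have "(\<Sum>j\<in>Basis. w \<bullet> j) = homogeneous_dim w"
  proof -
    have "Basis = range (\<lambda>i::'n. axis i (1::real))"
      by (auto simp: Basis_vec_def)
    moreover have "(\<Sum>j\<in>range (\<lambda>i::'n. axis i (1::real)). w \<bullet> j) = homogeneous_dim w"
      by (subst sum.reindex) (auto simp: inj_def axis_eq_axis homogeneous_dim_def inner_axis)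
    ultimately show ?thesis by simp
  qed
  then have prod: "(\<Prod>j\<in>Basis. \<bar>lam powr (w \<bullet> j)\<bar>) = lam powr homogeneous_dim w"
    using lam by (simp add: powr_sum flip: \<open>(\<Sum>j\<in>Basis. w \<bullet> j) = homogeneous_dim w\<close>)
  have "lborel = density (distr lborel borel T) (\<lambda>_. ennreal (lam powr homogeneous_dim w))"
    unfolding prod[symmetric] T_def using lam by (intro lborel_affine_euclidean) auto
  then have "(\<integral>\<^sup>+x. h x \<partial>lborel)
      = (\<integral>\<^sup>+x. h x \<partial>(density (distr lborel borel T) (\<lambda>_. ennreal (lam powr homogeneous_dim w))))"
    by (rule arg_cong)
  also have "\<dots> = ennreal (lam powr homogeneous_dim w) * (\<integral>\<^sup>+x. h (T x) \<partial>lborel)"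
    by (simp add: nn_integral_density nn_integral_distr nn_integral_cmult)
  finally have "ennreal (lam powr (- homogeneous_dim w)) * (\<integral>\<^sup>+x. h x \<partial>lborel)
      = ennreal (lam powr (- homogeneous_dim w) * lam powr homogeneous_dim w) * (\<integral>\<^sup>+x. h (T x) \<partial>lborel)"
    by (simp add: ennreal_mult mult.assoc)
  then show ?thesis
    using lam by (simp add: T powr_minus)
qed

lemma matrix_inv_cancel:
  assumes "invertible (P :: real^'n^'n)"
  shows "matrix_inv P *v (P *v x) = x" "P *v (matrix_inv P *v x) = x"
proof -
  have "P ** matrix_inv P = mat 1 \<and> matrix_inv P ** P = mat 1"
    unfolding matrix_inv_def by (rule someI_ex) (use assms in \<open>auto simp: invertible_def\<close>)
  then show "matrix_inv P *v (P *v x) = x" "P *v (matrix_inv P *v x) = x"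
    by (simp_all add: matrix_vector_mul_assoc)
qed

lemma matrix_vector_mult_continuous_on [continuous_intros]:
  fixes A :: "real^'n^'m"
  shows "continuous_on S g \<Longrightarrow> continuous_on S (\<lambda>x. A *v g x)"
  by (rule bounded_linear.continuous_on[OF matrix_vector_mul_bounded_linear])

lemma borel_measurable_matrix_vector_mult [measurable]:
  fixes A :: "real^'n^'m"
  shows "(\<lambda>x. A *v x) \<in> borel_measurable borel"
  by (intro borel_measurable_continuous_onI continuous_intros)

lemma nn_integral_dilation:
  fixes h :: "real^'n \<Rightarrow> ennreal"
  assumes P: "invertible P" and lam: "0 < lam" and h[measurable]: "h \<in> borel_measurable borel"
  shows "(\<integral>\<^sup>+x. h (dilation P w lam x) \<partial>lborel)
    = ennreal (lam powr (- homogeneous_dim w)) * (\<integral>\<^sup>+x. h x \<partial>lborel)"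
proof -
  define D where "D = (\<lambda>y::real^'n. \<chi> i. lam powr (w $ i) * y $ i)"
  have [measurable]: "D \<in> borel_measurable borel"
    unfolding D_def by (intro borel_measurable_continuous_onI continuous_intros)
  have "surj (\<lambda>x. matrix_inv P *v x)"
    using matrix_inv_cancel(1)[OF P] by (metis surjI)
  then obtain c where c: "\<And>g. g \<in> borel_measurable borel \<Longrightarrow>
      (\<integral>\<^sup>+x. g (matrix_inv P *v x) \<partial>lborel) = c * (\<integral>\<^sup>+x. g x \<partial>lborel)"
    using nn_integral_linear_surj[of "\<lambda>x. matrix_inv P *v x"] by auto
  have "(\<integral>\<^sup>+x. h (dilation P w lam x) \<partial>lborel) = c * (\<integral>\<^sup>+y. h (P *v D y) \<partial>lborel)"
  proof -
    have "(\<lambda>y. h (P *v D y)) \<in> borel_measurable borel" by measurable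
    from c[OF this] show ?thesis by (simp add: dilation_def D_def)
  qed
  also have "(\<integral>\<^sup>+y. h (P *v D y) \<partial>lborel)
      = ennreal (lam powr (- homogeneous_dim w)) * (\<integral>\<^sup>+y. h (P *v y) \<partial>lborel)"
    unfolding D_def by (rule nn_integral_diagonal[OF lam, of "\<lambda>y. h (P *v y)"]) measurable
  also have "c * (\<dots>) = ennreal (lam powr (- homogeneous_dim w)) * (c * (\<integral>\<^sup>+y. h (P *v y) \<partial>lborel))"
    by (simp add: mult.left_commute)
  \<comment> \<open>The factor \<open>c\<close> is read backwards, for \<open>h\<close> composed
    with \<open>P\<close>. Nothing is divided, so the argument is safe in
    \<open>ennreal\<close>.\<close>
  also have "c * (\<integral>\<^sup>+y. h (P *v y) \<partial>lborel) = (\<integral>\<^sup>+x. h x \<partial>lborel)"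
    using c[of "\<lambda>y. h (P *v y)"] by (simp add: matrix_inv_cancel[OF P])
  finally show ?thesis .
qed

section \<open>The dilation flow and its Euler derivative\<close>

lemma dilation_mult:
  assumes "invertible P" "0 < a" "0 < b"
  shows "dilation P w a (dilation P w b x) = dilation P w (a * b) x"
  using assms by (simp add: dilation_def matrix_inv_cancel powr_mult mult.assoc)

lemma dilation_1: "invertible P \<Longrightarrow> dilation P w 1 x = x"
  by (simp add: dilation_def matrix_inv_cancel)

lemma dilation_0: "dilation P w s 0 = 0"
  by (simp add: dilation_def zero_vec_def[symmetric])

text \<open>The matrix \<open>A = P diag(w) P^-1\<close> of the dilation group, applied to
  \<open>y\<close>.\<close>

definition dilation_generator :: "real^'n^'n \<Rightarrow> real^'n \<Rightarrow> real^'n \<Rightarrow> real^'n" where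
  "dilation_generator P w y = P *v (\<chi> i. w $ i * (matrix_inv P *v y) $ i)"

lemma dilation_has_vector_derivative:
  assumes P: "invertible P" and s: "0 < s"
  shows "((\<lambda>s. dilation P w s x) has_vector_derivative
           (1 / s) *\<^sub>R dilation_generator P w (dilation P w s x)) (at s)"
proof -
  have "((\<lambda>s. \<chi> i. s powr (w $ i) * (matrix_inv P *v x) $ i) has_vector_derivative
      (\<chi> i. w $ i * s powr (w $ i - 1) * (matrix_inv P *v x) $ i)) (at s)"
    unfolding has_vector_derivative_def
  proof (subst has_derivative_componentwise_within, intro ballI)
    fix b :: "real^'a" assume "b \<in> Basis"
    then obtain i where b: "b = axis i 1" by (auto simp: Basis_vec_def)
    have "((\<lambda>s. s powr (w $ i) * (matrix_inv P *v x) $ i) has_derivative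
       (\<lambda>h. h * (w $ i * s powr (w $ i - 1) * (matrix_inv P *v x) $ i))) (at s)"
    proof -
      have "((\<lambda>s. s powr (w $ i) * (matrix_inv P *v x) $ i) has_real_derivative
         (w $ i * s powr (w $ i - 1) * (matrix_inv P *v x) $ i)) (at s)"
        using s by (auto intro!: derivative_eq_intros)
      then show ?thesis by (simp add: has_field_derivative_def mult_commute_abs)
    qed
    then show "((\<lambda>s. (\<chi> i. s powr (w $ i) * (matrix_inv P *v x) $ i) \<bullet> b) has_derivative
       (\<lambda>h. (h *\<^sub>R (\<chi> i. w $ i * s powr (w $ i - 1) * (matrix_inv P *v x) $ i)) \<bullet> b)) (at s)"
      by (simp add: b inner_axis)
  qed
  from bounded_linear.has_vector_derivative[OF matrix_vector_mul_bounded_linear[of P] this]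
  have "((\<lambda>s. dilation P w s x) has_vector_derivative
      P *v (\<chi> i. w $ i * s powr (w $ i - 1) * (matrix_inv P *v x) $ i)) (at s)"
    by (simp add: dilation_def)
  moreover have "(\<chi> i. w $ i * s powr (w $ i - 1) * (matrix_inv P *v x) $ i)
      = (1 / s) *\<^sub>R (\<chi> i. w $ i * (s powr (w $ i) * (matrix_inv P *v x) $ i))"
    using s by (simp add: vec_eq_iff powr_diff)
  ultimately show ?thesis
    by (simp add: dilation_generator_def dilation_def matrix_inv_cancel[OF P] matrix_vector_mult_scaleR)
qed

text \<open>Joint continuity makes the set swept out by dilating a compact set, over a compact range
  of positive factors, compact.\<close>

lemma continuous_on_dilation:
  "continuous_on ({0<..} \<times> UNIV) (\<lambda>(s, x). dilation P w s x)"
  unfolding dilation_def case_prod_beta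
  by (intro continuous_intros) auto

lemma continuous_on_dilation_generator: "continuous_on S (dilation_generator P w)"
  unfolding dilation_generator_def by (intro continuous_intros)

text \<open>The vector field \<open>A x\<close> applied to \<open>f\<close>. Unlike the radial
  derivative it does not involve \<open>N\<close>, and it is continuous at the origin too.\<close>

definition euler_deriv :: "real^'n^'n \<Rightarrow> real^'n \<Rightarrow> (real^'n \<Rightarrow> complex) \<Rightarrow> real^'n \<Rightarrow> complex" where
  "euler_deriv P w f x = (\<Sum>i\<in>UNIV. dilation_generator P w x $ i *\<^sub>R partial_dir i f x)"

lemma continuous_on_euler_deriv: "smooth_map f \<Longrightarrow> continuous_on UNIV (euler_deriv P w f)"
  unfolding euler_deriv_def
  by (intro continuous_intros continuous_on_dilation_generator smooth_map_continuous_partial)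

lemma has_vector_derivative_along_dilation:
  assumes f: "smooth_map f" and P: "invertible P" and s: "0 < s"
  shows "((\<lambda>s. f (dilation P w s x)) has_vector_derivative
           (1 / s) *\<^sub>R euler_deriv P w f (dilation P w s x)) (at s)"
  unfolding has_vector_derivative_def
  by (rule has_derivative_eq_rhs[OF has_derivative_compose[OF
        dilation_has_vector_derivative[OF P s, unfolded has_vector_derivative_def]
        smooth_map_has_derivative[OF f]]])
     (simp add: euler_deriv_def fun_eq_iff scaleR_sum_right)

lemma radial_deriv_eq:
  assumes f: "smooth_map f" and P: "invertible P" and n: "0 < N x"
  shows "radial_deriv P w N f x = euler_deriv P w f x / N x"
proof -
  \<comment> \<open>The curve in \<open>radial_deriv\<close> starts from the unit point below
    \<open>x\<close> and passes through \<open>x\<close> at parameter \<open>N x\<close>; the factor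
    \<open>1 / s\<close> of the flow then becomes \<open>1 / N x\<close>.\<close>
  have "dilation P w (N x) (dilation P w (1 / N x) x) = x"
    using dilation_mult[OF P, of "N x" "1 / N x"] n by (simp add: dilation_1[OF P])
  then show ?thesis
    using vector_derivative_at[OF has_vector_derivative_along_dilation[OF f P n, of w "dilation P w (1 / N x) x"]]
    by (simp add: radial_deriv_def scaleR_conv_of_real)
qed

lemma euler_deriv_outside_support:
  assumes "compact K" "\<And>x. x \<notin> K \<Longrightarrow> f x = 0" "x \<notin> K"
  shows "euler_deriv P w f x = 0"
proof -
  have "partial_dir i f x = 0" for i
  proof -
    have "open ((\<lambda>t. x + t *\<^sub>R axis i 1) -` (- K))"
      using assms(1) by (intro open_vimage continuous_intros) (auto intro: compact_imp_closed)
    then have "((\<lambda>t. f (x + t *\<^sub>R axis i 1)) has_vector_derivative 0) (at 0)"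
      by (intro has_vector_derivative_transform_within_open[OF has_vector_derivative_const[of 0]])
         (use assms in auto)
    then show ?thesis
      unfolding partial_dir_def by (rule vector_derivative_at)
  qed
  then show ?thesis by (simp add: euler_deriv_def)
qed

section \<open>The Hardy identity\<close>

text \<open>After normalising both integrals to one, Young's inequality bounds the product pointwise
  by a convex combination whose integral is \<open>t + (1 - t) = 1\<close>. If an integral is zero,
  that function, and with it the product, vanishes almost everywhere.\<close>

lemma Holder_inequality_powr:
  fixes G H :: "'a \<Rightarrow> real"
  assumes G: "integrable M G" "\<And>x. 0 \<le> G x" and H: "integrable M H" "\<And>x. 0 \<le> H x"
    and t: "0 < t" "t < 1"
  shows "(\<integral>x. G x powr t * H x powr (1 - t) \<partial>M)
    \<le> (\<integral>x. G x \<partial>M) powr t * (\<integral>x. H x \<partial>M) powr (1 - t)"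
proof -
  define A B where "A = (\<integral>x. G x \<partial>M)" and "B = (\<integral>x. H x \<partial>M)"
  have nonneg: "0 \<le> A" "0 \<le> B"
    unfolding A_def B_def using G H by (auto intro: integral_nonneg_AE)
  show ?thesis
  proof (cases "A = 0 \<or> B = 0")
    case True
    then have "(AE x in M. G x = 0) \<or> (AE x in M. H x = 0)"
      unfolding A_def B_def using G H by (simp add: integral_nonneg_eq_0_iff_AE)
    then have "AE x in M. G x powr t * H x powr (1 - t) = 0"
      by (auto elim: eventually_mono)
    then have "(\<integral>x. G x powr t * H x powr (1 - t) \<partial>M) = 0"
      by (rule integral_eq_zero_AE)
    then show ?thesis by simp
  next
    case False
    then have pos: "0 < A" "0 < B" using nonneg by auto
    define C where "C = A powr t * B powr (1 - t)"
    have "C \<ge> 0" by (simp add: C_def)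
    have bound: "G x powr t * H x powr (1 - t) \<le> C * (t * (G x / A) + (1 - t) * (H x / B))" for x
    proof (cases "G x = 0 \<or> H x = 0")
      case True
      then show ?thesis using t pos G(2)[of x] H(2)[of x] \<open>C \<ge> 0\<close> by auto
    next
      case False
      then have "0 < G x" "0 < H x" using G(2)[of x] H(2)[of x] by auto
      then have "(G x / A) powr t * (H x / B) powr (1 - t) \<le> t * (G x / A) + (1 - t) * (H x / B)"
        using pos t by (intro Youngs_inequality_0) auto
      moreover have "C * ((G x / A) powr t * (H x / B) powr (1 - t)) = G x powr t * H x powr (1 - t)"
        using pos \<open>0 < G x\<close> \<open>0 < H x\<close> by (simp add: C_def powr_divide)
      ultimately show ?thesis
        using mult_left_mono[OF _ \<open>C \<ge> 0\<close>] by metis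
    qed
    have "(\<integral>x. G x powr t * H x powr (1 - t) \<partial>M)
        \<le> (\<integral>x. C * (t * (G x / A) + (1 - t) * (H x / B)) \<partial>M)"
      using G H t pos \<open>C \<ge> 0\<close> by (intro integral_mono' bound) auto
    also have "\<dots> = C * (t * (A / A) + (1 - t) * (B / B))"
      using G(1) H(1) by (simp add: A_def B_def)
    finally show ?thesis using pos by (simp add: C_def A_def B_def)
  qed
qed

section \<open>Weighted integrals of functions supported away from the origin\<close>

locale quasi_normed_dilation =
  fixes P :: "real^'n^'n" and w :: "real^'n" and N :: "real^'n \<Rightarrow> real"
  assumes invP: "invertible P"
    and cont_N: "continuous_on UNIV N"
    and N_nonneg: "0 \<le> N x"
    and N_dilation: "0 < s \<Longrightarrow> N (dilation P w s x) = s * N x"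
    and N_eq_0_iff: "N x = 0 \<longleftrightarrow> x = 0"
begin

abbreviation "D \<equiv> dilation P w"
abbreviation "E \<equiv> euler_deriv P w"
abbreviation "Q \<equiv> homogeneous_dim w"

lemma N_pos: "x \<noteq> 0 \<Longrightarrow> 0 < N x"
  using N_nonneg[of x] N_eq_0_iff[of x] by simp

lemma borel_measurable_N [measurable]: "N \<in> borel_measurable borel"
  using cont_N by (rule borel_measurable_continuous_onI)

lemma continuous_on_N_powr: "0 \<notin> K \<Longrightarrow> continuous_on K (\<lambda>x. N x powr a)"
  using N_eq_0_iff by (intro continuous_intros continuous_on_subset[OF cont_N]) auto

text \<open>The weight can blow up only at the origin, which \<open>K\<close> avoids; hence the
  exponent \<open>a\<close> may be any real number.\<close>

lemma integrable_N_powr_times: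
  assumes "compact K" "0 \<notin> K" "continuous_on UNIV g" "\<And>x. x \<notin> K \<Longrightarrow> g x = (0::real)"
  shows "integrable lborel (\<lambda>x. N x powr a * g x)"
proof -
  have "integrable lborel (\<lambda>x. indicator K x *\<^sub>R (N x powr a * g x))"
    using assms by (intro borel_integrable_compact continuous_intros continuous_on_N_powr)
      (auto intro: continuous_on_subset)
  also have "(\<lambda>x. indicator K x *\<^sub>R (N x powr a * g x)) = (\<lambda>x. N x powr a * g x)"
    using assms(4) by (auto simp: fun_eq_iff indicator_def)
  finally show ?thesis .
qed

lemma integral_dilation:
  fixes H :: "real^'n \<Rightarrow> real"
  assumes H: "integrable lborel H" "\<And>x. 0 \<le> H x" and s: "0 < s"
  shows "has_bochner_integral lborel (\<lambda>x. H (D s x)) (s powr (- Q) * (\<integral>x. H x \<partial>lborel))"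
proof (rule has_bochner_integral_nn_integral)
  have [measurable]: "H \<in> borel_measurable borel"
    using H(1) by simp
  have "continuous_on UNIV (D s)"
    unfolding dilation_def by (intro continuous_intros)
  then have [measurable]: "D s \<in> borel_measurable borel"
    by (rule borel_measurable_continuous_onI)
  show "(\<lambda>x. H (D s x)) \<in> borel_measurable lborel" by measurable
  have "(\<integral>\<^sup>+x. ennreal (H (D s x)) \<partial>lborel) = ennreal (s powr (- Q)) * (\<integral>\<^sup>+x. ennreal (H x) \<partial>lborel)"
    by (rule nn_integral_dilation[OF invP s]) measurable
  also have "(\<integral>\<^sup>+x. ennreal (H x) \<partial>lborel) = ennreal (\<integral>x. H x \<partial>lborel)"
    using H by (intro nn_integral_eq_integral) auto
  finally show "(\<integral>\<^sup>+x. ennreal (H (D s x)) \<partial>lborel) = ennreal (s powr (- Q) * (\<integral>x. H x \<partial>lborel))"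
    using H by (simp add: ennreal_mult integral_nonneg_AE)
qed (use H in \<open>auto intro!: mult_nonneg_nonneg integral_nonneg_AE\<close>)

end

locale dilation_test_fun = quasi_normed_dilation P w N
  for P :: "real^'n^'n" and w :: "real^'n" and N :: "real^'n \<Rightarrow> real" +
  fixes f :: "real^'n \<Rightarrow> complex" and K :: "(real^'n) set"
  assumes smooth: "smooth_map f"
    and K: "compact K" "0 \<notin> K"
    and support: "x \<notin> K \<Longrightarrow> f x = 0"
begin

lemma cont_f: "continuous_on S f"
  using smooth_map_continuous[OF smooth] by (rule continuous_on_subset) simp

lemma cont_E: "continuous_on S (E f)"
  using continuous_on_euler_deriv[OF smooth] by (rule continuous_on_subset) simp

lemma E_outside: "x \<notin> K \<Longrightarrow> E f x = 0"
  by (rule euler_deriv_outside_support[OF K(1) support])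

lemma borel_measurable_f [measurable]: "f \<in> borel_measurable borel"
  using cont_f by (rule borel_measurable_continuous_onI)

lemma borel_measurable_cnj_E [measurable]: "(\<lambda>x. cnj (E f x)) \<in> borel_measurable borel"
  by (intro borel_measurable_continuous_onI continuous_intros cont_E)

lemma continuous_on_norm_powr: "0 < r \<Longrightarrow> continuous_on S (\<lambda>x. norm (f x) powr r)"
  by (intro continuous_on_powr' continuous_intros cont_f) auto

lemma integrable_weighted_norm_powr:
  "0 < r \<Longrightarrow> integrable lborel (\<lambda>x. N x powr a * norm (f x) powr r)"
  by (intro integrable_N_powr_times[OF K] continuous_on_norm_powr) (auto simp: support)

text \<open>This is \<open>E(|f|^p)\<close>; it takes the value 0 at zeros of \<open>f\<close>,
  whatever the sign of \<open>p - 2\<close>.\<close>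

definition euler_powr :: "real \<Rightarrow> real^'n \<Rightarrow> real" where
  "euler_powr p x = p * norm (f x) powr (p - 2) * Re (f x * cnj (E f x))"

lemma norm_powr_along_dilation:
  assumes p: "1 < p" and s: "0 < s"
  shows "((\<lambda>s. norm (f (D s x)) powr p) has_real_derivative euler_powr p (D s x) / s) (at s)"
  using norm_powr_has_real_derivative[OF has_vector_derivative_along_dilation[OF smooth invP s] p]
  by (simp add: euler_powr_def field_simps)

text \<open>Cauchy-Schwarz absorbs one factor \<open>norm (f y)\<close>, so the exponent
  \<open>p - 2\<close> rises to \<open>p - 1 > 0\<close> and the bound \<open>B\<close> is
  continuous on \<open>K\<close>.\<close>

lemma euler_powr_bounded:
  assumes p: "1 < p"
  obtains M where "0 \<le> M" "\<And>y. \<bar>euler_powr p y\<bar> \<le> M"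
proof -
  define B where "B = (\<lambda>y. p * norm (f y) powr (p - 1) * norm (E f y))"
  have "continuous_on K B"
    unfolding B_def using p by (intro continuous_intros continuous_on_norm_powr cont_E) auto
  then have "bounded (B ` K)"
    using K compact_continuous_image compact_imp_bounded by blast
  then obtain M where M: "0 < M" "\<And>y. y \<in> K \<Longrightarrow> \<bar>B y\<bar> \<le> M"
    by (auto simp: bounded_pos)
  have "\<bar>euler_powr p y\<bar> \<le> M" for y
  proof (cases "y \<in> K \<and> f y \<noteq> 0")
    case True
    have "\<bar>euler_powr p y\<bar> = p * norm (f y) powr (p - 2) * \<bar>Re (f y * cnj (E f y))\<bar>"
      using p by (simp add: euler_powr_def abs_mult)
    also have "\<dots> \<le> p * norm (f y) powr (p - 2) * (norm (f y) * norm (E f y))"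
      using p abs_Re_le_cmod[of "f y * cnj (E f y)"] by (intro mult_left_mono) (auto simp: norm_mult)
    also have "\<dots> = B y"
      using True powr_add[of "norm (f y)" "p - 2" 1] by (simp add: B_def)
    finally show ?thesis using M(2)[of y] True by simp
  next
    case False
    then show ?thesis using M(1) support[of y] by (auto simp: euler_powr_def)
  qed
  then show thesis using M(1) that by (meson less_imp_le)
qed

text \<open>Differentiate \<open>\<integral> N\<^sup>-\<^sup>\<alpha> |f \<circ> D\<^sub>s|\<^sup>p = s\<^sup>\<alpha>\<^sup>-\<^sup>Q \<integral> N\<^sup>-\<^sup>\<alpha> |f|\<^sup>p\<close> at \<open>s = 1\<close>;
  this replaces integration by parts in polar coordinates.\<close>

lemma integral_euler_powr:
  assumes p: "1 < p"
  shows "integrable lborel (\<lambda>x. N x powr (- \<alpha>) * euler_powr p x)" (is ?int)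
    and "(\<integral>x. N x powr (- \<alpha>) * euler_powr p x \<partial>lborel)
      = (\<alpha> - Q) * (\<integral>x. N x powr (- \<alpha>) * norm (f x) powr p \<partial>lborel)" (is ?eq)
proof -
  define A where "A = (\<integral>x. N x powr (- \<alpha>) * norm (f x) powr p \<partial>lborel)"
  define s :: "nat \<Rightarrow> real" where "s = (\<lambda>n. 1 + 1 / real (Suc n))"
  have s: "1 < s n" "s n \<le> 2" for n
    by (auto simp: s_def)
  have s_lim: "filterlim s (at 1) sequentially"
  proof (rule filterlim_atI)
    show "s \<longlonglongrightarrow> 1"
      unfolding s_def using tendsto_add[OF tendsto_const[of 1] LIMSEQ_Suc[OF lim_1_over_n]] by simp
  qed (use s in \<open>auto simp: less_imp_neq[symmetric]\<close>)
  define \<phi> where "\<phi> = (\<lambda>n x. N x powr (- \<alpha>) *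
    ((norm (f (D (s n) x)) powr p - norm (f x) powr p) / (s n - 1)))"
  \<comment> \<open>The factors \<open>s n\<close> lie in \<open>(1, 2]\<close>, so a point that
    \<open>D (s n)\<close> sends into \<open>K\<close> is a dilate of a point of \<open>K\<close> by
    a factor in \<open>[1/2, 1]\<close>. All \<open>\<phi> n\<close> vanish off this one compact
    set.\<close>
  define K' where "K' = (\<lambda>(t, y). D t y) ` ({1/2..1} \<times> K)"
  have K': "compact K'"
    unfolding K'_def using K
    by (intro compact_continuous_image continuous_on_subset[OF continuous_on_dilation] compact_Times) auto
  have "0 \<notin> K'"
  proof
    assume "0 \<in> K'"
    then obtain t y where ty: "1 / 2 \<le> t" "y \<in> K" "D t y = 0"
      by (auto simp: K'_def)
    have "D (1 / t) (D t y) = y"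
      using ty(1) dilation_mult[OF invP, of "1 / t" t] by (simp add: dilation_1[OF invP])
    then show False
      using ty K by (simp add: dilation_0)
  qed
  have in_K': "x \<in> K'" if "D t x \<in> K" "1 \<le> t" "t \<le> 2" for x t
  proof -
    have "x = D (1 / t) (D t x)"
      using that dilation_mult[OF invP, of "1 / t" t] by (simp add: dilation_1[OF invP])
    then show ?thesis
      unfolding K'_def using that by (intro image_eqI[of _ _ "(1 / t, D t x)"]) (auto simp: field_simps)
  qed
  obtain M where M: "0 \<le> M" "\<And>y. \<bar>euler_powr p y\<bar> \<le> M"
    using euler_powr_bounded[OF p] by blast
  have meas: "\<phi> n \<in> borel_measurable lborel" for n
  proof -
    have "continuous_on UNIV (D (s n))"
      unfolding dilation_def by (intro continuous_intros)
    then have [measurable]: "D (s n) \<in> borel_measurable borel"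
      by (rule borel_measurable_continuous_onI)
    show ?thesis unfolding \<phi>_def by measurable
  qed
  have meas': "(\<lambda>x. N x powr (- \<alpha>) * euler_powr p x) \<in> borel_measurable lborel"
    unfolding euler_powr_def by measurable
  have lim: "(\<lambda>n. \<phi> n x) \<longlonglongrightarrow> N x powr (- \<alpha>) * euler_powr p x" for x
  proof -
    have "((\<lambda>t. (norm (f (D t x)) powr p - norm (f x) powr p) / (t - 1)) \<longlongrightarrow> euler_powr p x) (at 1)"
      using norm_powr_along_dilation[OF p, of 1 x]
      by (simp add: has_field_derivative_iff dilation_1[OF invP])
    from tendsto_mult[OF tendsto_const filterlim_compose[OF this s_lim]] show ?thesis
      unfolding \<phi>_def .
  qed
  have bound: "norm (\<phi> n x) \<le> indicator K' x *\<^sub>R (N x powr (- \<alpha>) * M)" for n x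
  proof (cases "x \<in> K'")
    case True
    \<comment> \<open>The mean value theorem replaces the difference quotient by a derivative at
      some \<open>z > 1\<close>, and dividing by \<open>z\<close> can only help against the bound
      \<open>M\<close>.\<close>
    obtain z where z: "1 < z" "z < s n"
      "norm (f (D (s n) x)) powr p - norm (f (D 1 x)) powr p = (s n - 1) * (euler_powr p (D z x) / z)"
      using MVT2[OF s(1), of n "\<lambda>t. norm (f (D t x)) powr p" "\<lambda>t. euler_powr p (D t x) / t"]
        norm_powr_along_dilation[OF p] by auto
    define v where "v = euler_powr p (D z x) / z"
    have "\<phi> n x = N x powr (- \<alpha>) * v"
      unfolding v_def using z(3) s(1)[of n] by (simp add: \<phi>_def dilation_1[OF invP])
    moreover have "\<bar>v\<bar> \<le> M"
      unfolding v_def using M(2)[of "D z x"] z(1) by (simp add: field_simps)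
        (metis M(1) less_imp_le mult_left_mono mult_1 mult.commute order.trans)
    ultimately show ?thesis
      using True by (simp add: abs_mult mult_left_mono)
  next
    case False
    have "f (D (s n) x) = 0" "f x = 0"
      using False in_K'[of "s n" x] in_K'[of 1 x] s[of n] support dilation_1[OF invP] by fastforce+
    then show ?thesis using False by (simp add: \<phi>_def)
  qed
  have dom: "integrable lborel (\<lambda>x. indicator K' x *\<^sub>R (N x powr (- \<alpha>) * M))"
    using K' \<open>0 \<notin> K'\<close> by (intro borel_integrable_compact continuous_intros continuous_on_N_powr)
  show ?int
    by (rule integrable_dominated_convergence[where s = \<phi>, OF meas' meas dom AE_I2[OF lim] AE_I2[OF bound]])
  have conv: "(\<lambda>n. \<integral>x. \<phi> n x \<partial>lborel) \<longlonglongrightarrow> (\<integral>x. N x powr (- \<alpha>) * euler_powr p x \<partial>lborel)"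
    by (rule integral_dominated_convergence[where s = \<phi>, OF meas' meas dom AE_I2[OF lim] AE_I2[OF bound]])
  have scaled: "has_bochner_integral lborel (\<lambda>x. N x powr (- \<alpha>) * norm (f (D t x)) powr p)
      (t powr (\<alpha> - Q) * A)" if t: "0 < t" for t
  proof -
    \<comment> \<open>Homogeneity of \<open>N\<close> costs a factor
      \<open>t powr (- \<alpha>)\<close>, which \<open>t powr \<alpha>\<close> undoes; the change of
      variables contributes \<open>t powr (- Q)\<close>.\<close>
    have "has_bochner_integral lborel
        (\<lambda>x. t powr \<alpha> * (N (D t x) powr (- \<alpha>) * norm (f (D t x)) powr p)) (t powr \<alpha> * (t powr (- Q) * A))"
      unfolding A_def using p t
      by (intro has_bochner_integral_mult_right integral_dilation integrable_weighted_norm_powr) auto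
    moreover have "t powr \<alpha> * (N (D t x) powr (- \<alpha>) * norm (f (D t x)) powr p)
        = N x powr (- \<alpha>) * norm (f (D t x)) powr p" for x
      using t N_nonneg[of x] by (simp add: N_dilation powr_mult powr_minus field_simps)
    ultimately show ?thesis
      by (simp add: powr_diff powr_minus field_simps)
  qed
  have "(\<integral>x. \<phi> n x \<partial>lborel) = (s n powr (\<alpha> - Q) - 1) / (s n - 1) * A" for n
  proof -
    have "has_bochner_integral lborel (\<lambda>x. N x powr (- \<alpha>) * norm (f x) powr p) A"
      using scaled[of 1] by (simp add: dilation_1[OF invP])
    from has_bochner_integral_divide_zero[OF has_bochner_integral_diff[OF scaled this], of "s n - 1" "s n"]
    have "has_bochner_integral lborel (\<phi> n) ((s n powr (\<alpha> - Q) * A - A) / (s n - 1))"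
      using s(1)[of n] unfolding \<phi>_def by (simp add: right_diff_distrib)
    then show ?thesis
      by (simp add: has_bochner_integral_iff algebra_simps)
  qed
  moreover have "((\<lambda>t. (t powr (\<alpha> - Q) - 1) / (t - 1)) \<longlongrightarrow> \<alpha> - Q) (at 1)"
    using has_real_derivative_powr[of 1 "\<alpha> - Q"] by (simp add: has_field_derivative_iff)
  then have "(\<lambda>n. (s n powr (\<alpha> - Q) - 1) / (s n - 1) * A) \<longlonglongrightarrow> (\<alpha> - Q) * A"
    by (intro tendsto_mult tendsto_const filterlim_compose[OF _ s_lim])
  ultimately show ?eq
    using conv LIMSEQ_unique unfolding A_def by simp
qed

lemma Lnorm_weighted:
  "Lnorm r (\<lambda>x. complex_of_real (N x powr a) * f x)
    = (\<integral>x. N x powr (a * r) * norm (f x) powr r \<partial>lborel) powr (1 / r)"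
  unfolding Lnorm_def by (simp add: norm_mult powr_mult powr_powr)

text \<open>Subtracting the remainder \<open>C\<^sub>p\<close> turns the Hardy inequality into an identity.\<close>

lemma hardy_bracket_eq:
  assumes p: "1 < p"
  shows "hardy_bracket P w N p \<alpha> f
    = \<bar>(Q - \<alpha>) / p\<bar> powr p * (\<integral>x. N x powr (- \<alpha>) * norm (f x) powr p \<partial>lborel)"
proof -
  define \<beta> where "\<beta> = (Q - \<alpha>) / p"
  define A where "A = (\<integral>x. N x powr (- \<alpha>) * norm (f x) powr p \<partial>lborel)"
  define u where "u = (\<lambda>x. radial_deriv P w N f x / complex_of_real (N x powr (\<alpha> / p - 1)))"
  define g where "g = (\<lambda>x. f x / complex_of_real (N x powr (\<alpha> / p)))"
  \<comment> \<open>At the origin both sides are 0, by \<open>0 powr a = 0\<close> and division by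
    zero.\<close>
  have u: "u x = complex_of_real (N x powr (- \<alpha> / p)) * E f x" for x
  proof (cases "x = 0")
    case True
    then show ?thesis using N_eq_0_iff[of x] by (simp add: u_def)
  next
    case False
    then show ?thesis using N_pos[of x] radial_deriv_eq[OF smooth invP, of N x w]
      by (simp add: u_def powr_diff powr_minus field_simps)
  qed
  have norm_u: "norm (u x) powr p = N x powr (- \<alpha>) * norm (E f x) powr p" for x
    using p by (simp add: u norm_mult powr_mult powr_powr)
  have int_u: "integrable lborel (\<lambda>x. norm (u x) powr p)"
    unfolding norm_u using p
    by (intro integrable_N_powr_times[OF K] continuous_on_powr' continuous_intros cont_E)
       (auto simp: E_outside)
  \<comment> \<open>The difference of \<open>norm (u x) powr p\<close> and \<open>C_p\<close>. The
    term in \<open>euler_powr\<close> is the cross term \<open>Re (g * cnj u)\<close>; the square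
    term contributes the \<open>- p\<close> in \<open>1 - p\<close>.\<close>
  define R where "R = (\<lambda>x. (1 - p) * \<bar>\<beta>\<bar> powr p * (N x powr (- \<alpha>) * norm (f x) powr p)
      - \<bar>\<beta>\<bar> powr (p - 2) * \<beta> * (N x powr (- \<alpha>) * euler_powr p x))"
  have Cp_eq: "Cp p (u x) (u x + complex_of_real \<beta> * g x) = norm (u x) powr p - R x" for x
  proof (cases "\<beta> = 0 \<or> f x = 0")
    \<comment> \<open>Here the arguments of \<open>C_p\<close> coincide, so its special clause
      applies, and \<open>R x\<close> is 0.\<close>
    case True
    then show ?thesis by (auto simp: Cp_def R_def g_def euler_powr_def)
  next
    case False
    then have "x \<noteq> 0" using support[of x] K(2) by auto
    then have n: "0 < N x" by (rule N_pos)
    have b: "\<beta> \<noteq> 0" and fx: "f x \<noteq> 0" using False by auto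
    define m where "m = N x powr (- \<alpha> / p)"
    have m: "0 < m" using n by (simp add: m_def)
    have mp: "m powr p = N x powr (- \<alpha>)" using p by (simp add: m_def powr_powr)
    have gx: "g x = of_real m * f x" and ux: "u x = of_real m * E f x"
      using n by (simp_all add: g_def u m_def powr_minus field_simps)
    have ng: "norm (complex_of_real \<beta> * g x) = \<bar>\<beta>\<bar> * m * norm (f x)"
      using m by (simp add: gx norm_mult)
    have Re1: "Re (- (complex_of_real \<beta> * g x) * cnj (u x + complex_of_real \<beta> * g x))
        = - \<beta> * m\<^sup>2 * Re (f x * cnj (E f x)) - \<beta>\<^sup>2 * m\<^sup>2 * (norm (f x))\<^sup>2"
      unfolding cmod_power2 by (simp add: gx ux algebra_simps power2_eq_square)
    have sq: "c powr (p - 2) * c\<^sup>2 = c powr p" if "0 < c" for c :: real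
      using that powr_add[of c "p - 2" 2] by (simp add: powr_numeral)
    have "p * norm (complex_of_real \<beta> * g x) powr (p - 2)
          * Re (- (complex_of_real \<beta> * g x) * cnj (u x + complex_of_real \<beta> * g x))
        = - (\<bar>\<beta>\<bar> powr (p - 2)) * \<beta> * (m powr (p - 2) * m\<^sup>2) * euler_powr p x
          - p * (\<bar>\<beta>\<bar> powr (p - 2) * \<bar>\<beta>\<bar>\<^sup>2) * (m powr (p - 2) * m\<^sup>2) * (norm (f x) powr (p - 2) * (norm (f x))\<^sup>2)"
      unfolding ng Re1 using m by (simp add: powr_mult euler_powr_def algebra_simps)
    also have "\<dots> = - (\<bar>\<beta>\<bar> powr (p - 2)) * \<beta> * N x powr (- \<alpha>) * euler_powr p x
          - p * \<bar>\<beta>\<bar> powr p * N x powr (- \<alpha>) * norm (f x) powr p"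
      using b fx m sq[of "\<bar>\<beta>\<bar>"] sq[of m] sq[of "norm (f x)"] by (simp only: mp) simp
    finally have main: "p * norm (complex_of_real \<beta> * g x) powr (p - 2)
          * Re (- (complex_of_real \<beta> * g x) * cnj (u x + complex_of_real \<beta> * g x)) = \<dots>" .
    have np: "norm (complex_of_real \<beta> * g x) powr p = \<bar>\<beta>\<bar> powr p * N x powr (- \<alpha>) * norm (f x) powr p"
      unfolding ng using m by (simp add: powr_mult mp)
    have "u x \<noteq> u x + complex_of_real \<beta> * g x"
      using b fx m by (simp add: gx)
    moreover have "u x - (u x + complex_of_real \<beta> * g x) = - (complex_of_real \<beta> * g x)"
      by simp
    ultimately have "Cp p (u x) (u x + complex_of_real \<beta> * g x)
        = norm (u x) powr p - norm (complex_of_real \<beta> * g x) powr p - p * norm (complex_of_real \<beta> * g x) powr (p - 2)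
          * Re (- (complex_of_real \<beta> * g x) * cnj (u x + complex_of_real \<beta> * g x))"
      unfolding Cp_def by (simp only: if_False norm_minus_cancel)
    then show ?thesis
      unfolding main np R_def by (simp add: algebra_simps)
  qed
  have int_f: "integrable lborel (\<lambda>x. N x powr (- \<alpha>) * norm (f x) powr p)"
    using p by (intro integrable_weighted_norm_powr) simp
  note int_E = integral_euler_powr[OF p, of \<alpha>]
  have int_R: "integrable lborel R"
    unfolding R_def using int_f int_E by (intro Bochner_Integration.integrable_diff integrable_mult_right)
  have "hardy_bracket P w N p \<alpha> f
      = Lnorm p u powr p - (\<integral>x. Cp p (u x) (u x + complex_of_real \<beta> * g x) \<partial>lborel)"
    by (simp add: hardy_bracket_def Let_def u_def \<beta>_def g_def)
  also have "Lnorm p u powr p = (\<integral>x. norm (u x) powr p \<partial>lborel)"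
    using p by (simp add: Lnorm_def powr_powr integral_nonneg_AE)
  also have "(\<integral>x. Cp p (u x) (u x + complex_of_real \<beta> * g x) \<partial>lborel)
      = (\<integral>x. norm (u x) powr p \<partial>lborel) - (\<integral>x. R x \<partial>lborel)"
    unfolding Cp_eq by (rule Bochner_Integration.integral_diff[OF int_u int_R])
  also have "(\<integral>x. R x \<partial>lborel)
      = (1 - p) * \<bar>\<beta>\<bar> powr p * A - \<bar>\<beta>\<bar> powr (p - 2) * \<beta> * ((\<alpha> - Q) * A)"
    unfolding R_def A_def using int_f int_E
    by (subst Bochner_Integration.integral_diff) (auto intro!: integrable_mult_right)
  also have "(\<alpha> - Q) * A = - (p * \<beta> * A)"
    using p by (simp add: \<beta>_def left_diff_distrib)
  \<comment> \<open>Subtracting this from the first term leaves \<open>(1 - p) + p = 1\<close> times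
    \<open>\<bar>\<beta>\<bar> powr p * A\<close>.\<close>
  also have "\<bar>\<beta>\<bar> powr (p - 2) * \<beta> * - (p * \<beta> * A) = - p * \<bar>\<beta>\<bar> powr p * A"
  proof (cases "\<beta> = 0")
    case False
    then have "\<bar>\<beta>\<bar> powr (p - 2) * \<beta>\<^sup>2 = \<bar>\<beta>\<bar> powr p"
      using powr_add[of "\<bar>\<beta>\<bar>" "p - 2" 2] by (simp add: powr_numeral)
    then show ?thesis by (simp add: power2_eq_square algebra_simps)
  qed simp
  finally show ?thesis
    by (simp add: A_def \<beta>_def algebra_simps)
qed

text \<open>By the identity for the bracket, its power \<open>\<delta> / p\<close> splits into the
  constant of the theorem and a power of a weighted norm of \<open>f\<close>. The convention of
  \<open>rpow0\<close> keeps the splitting valid at \<open>\<delta> = 0\<close>, even if a base is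
  0.\<close>

lemma CKN_ineq_iff:
  assumes p: "1 < p"
  shows "CKN_ineq P w N p q r \<delta> \<alpha> b c C f \<longleftrightarrow>
    C * (\<integral>x. N x powr (\<alpha> * c / p * r) * norm (f x) powr r \<partial>lborel) powr (1 / r)
    \<le> rpow0 \<bar>(Q - \<alpha>) / p\<bar> \<delta>
      * rpow0 ((\<integral>x. N x powr (- \<alpha>) * norm (f x) powr p \<partial>lborel) powr (1 / p)) \<delta>
      * rpow0 ((\<integral>x. N x powr (\<alpha> * b / p * q) * norm (f x) powr q \<partial>lborel) powr (1 / q)) (1 - \<delta>)"
proof -
  have "0 \<le> (\<integral>x. N x powr (- \<alpha>) * norm (f x) powr p \<partial>lborel)"
    by (simp add: integral_nonneg_AE)
  then have "rpow0 (hardy_bracket P w N p \<alpha> f) (\<delta> / p) = rpow0 \<bar>(Q - \<alpha>) / p\<bar> \<delta>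
      * rpow0 ((\<integral>x. N x powr (- \<alpha>) * norm (f x) powr p \<partial>lborel) powr (1 / p)) \<delta>"
    using p by (simp add: hardy_bracket_eq[OF p] rpow0_def powr_mult powr_powr)
  then show ?thesis
    by (simp add: CKN_ineq_def Lnorm_weighted)
qed

end

section \<open>The interpolation inequality and its extremals\<close>

theorem theorem5p3:
  fixes mul :: "real^'n \<Rightarrow> real^'n \<Rightarrow> real^'n" and ginv :: "real^'n \<Rightarrow> real^'n"
    and P :: "real^'n^'n" and w :: "real^'n" and N :: "real^'n \<Rightarrow> real"
    and p q r \<delta> \<alpha> b c :: real
  assumes G: "homogeneous_Lie_group mul ginv P w"
    and N: "hom_quasi_norm ginv P w N"
    and p: "1 < p" and q: "1 < q" and r: "0 < r" and pqr: "r \<le> p + q"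
    and d01: "0 \<le> \<delta>" "\<delta> \<le> 1" and d_lo: "(r - q) / r \<le> \<delta>" and d_hi: "\<delta> \<le> p / r"
    and scal: "\<delta> * r / p + (1 - \<delta>) * r / q = 1"
    and cdef: "c = - \<delta> + b * (1 - \<delta>)"
  shows "(\<forall>f. test_fun f \<longrightarrow>
            CKN_ineq P w N p q r \<delta> \<alpha> b c (rpow0 \<bar>(homogeneous_dim w - \<alpha>) / p\<bar> \<delta>) f)
       \<and> (\<alpha> \<noteq> homogeneous_dim w \<and> ((q = p \<and> b = -1) \<or> \<delta> = 0 \<or> \<delta> = 1) \<longrightarrow>
            (\<forall>C > rpow0 \<bar>(homogeneous_dim w - \<alpha>) / p\<bar> \<delta>.
               \<exists>f. test_fun f \<and> \<not> CKN_ineq P w N p q r \<delta> \<alpha> b c C f))"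
proof -
  interpret quasi_normed_dilation P w N
    using G N unfolding homogeneous_Lie_group_def hom_quasi_norm_def by unfold_locales auto
  define C0 where "C0 = rpow0 \<bar>(Q - \<alpha>) / p\<bar> \<delta>"
  have "C0 \<ge> 0" by (simp add: C0_def rpow0_def)
  define J where "J = (\<lambda>f a t. \<integral>x. N x powr a * norm (f x :: complex) powr t \<partial>lborel)"
  have J_nonneg: "0 \<le> J f a t" for f a t
    unfolding J_def by (simp add: integral_nonneg_AE)
  have ckn: "CKN_ineq P w N p q r \<delta> \<alpha> b c C f \<longleftrightarrow>
      C * J f (\<alpha> * c / p * r) r powr (1 / r) \<le>
      C0 * rpow0 (J f (- \<alpha>) p powr (1 / p)) \<delta> * rpow0 (J f (\<alpha> * b / p * q) q powr (1 / q)) (1 - \<delta>)"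
    if f: "test_fun f" for f C
  proof -
    obtain K where "compact K" "0 \<notin> K" "\<And>x. x \<notin> K \<Longrightarrow> f x = 0"
      using f unfolding test_fun_def by blast
    then interpret dilation_test_fun P w N f K
      using f by unfold_locales (auto simp: test_fun_def)
    show ?thesis unfolding C0_def J_def by (rule CKN_ineq_iff[OF p])
  qed
  have r0: "r = q \<and> c = b" if "\<delta> = 0"
    using scal cdef q that by (simp add: field_simps)
  have r1: "r = p \<and> c = -1" if "\<delta> = 1"
    using scal cdef p that by (simp add: field_simps)
  have rp: "r = p \<and> c = -1" if "q = p \<and> b = -1"
    using scal cdef p that by (simp add: field_simps)
  \<comment> \<open>For \<delta> in {0, 1} one factor on the right is 1 and the other is the left
    norm. For \<open>q = p\<close> and \<open>b = -1\<close> all three norms agree, and the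
    exponents \<delta> and \<open>1 - \<delta>\<close> add up to 1.\<close>
  have end0: "J f (\<alpha> * c / p * r) r powr (1 / r) =
      rpow0 (J f (- \<alpha>) p powr (1 / p)) \<delta> * rpow0 (J f (\<alpha> * b / p * q) q powr (1 / q)) (1 - \<delta>)"
    if "(q = p \<and> b = -1) \<or> \<delta> = 0 \<or> \<delta> = 1" for f
  proof -
    consider "\<delta> = 0" | "\<delta> = 1" | "q = p \<and> b = -1" "\<delta> \<noteq> 0" "\<delta> \<noteq> 1" using \<open>_ \<or> _\<close> by blast
    then show ?thesis
    proof cases
      case 1
      then show ?thesis using r0 J_nonneg by (simp add: rpow0_def)
    next
      case 2
      then show ?thesis using r1 p J_nonneg by (simp add: rpow0_def)
    next
      case 3
      then show ?thesis using rp p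
        by (simp add: rpow0_def flip: powr_add)
    qed
  qed
  have "CKN_ineq P w N p q r \<delta> \<alpha> b c C0 f" if f: "test_fun f" for f
  proof (cases "\<delta> = 0 \<or> \<delta> = 1")
    case True
    then show ?thesis unfolding ckn[OF f] using end0 by (simp add: mult.assoc)
  next
    case False
    then have d: "0 < \<delta>" "\<delta> < 1" using d01 by auto
    obtain K where "compact K" "0 \<notin> K" "\<And>x. x \<notin> K \<Longrightarrow> f x = 0"
      using f unfolding test_fun_def by blast
    then interpret dilation_test_fun P w N f K
      using f by unfold_locales (auto simp: test_fun_def)
    \<comment> \<open>The weight for Hoelder's inequality: the scaling condition says precisely that
      the complementary weight is \<open>(1 - \<delta>) * r / q\<close>.\<close>
    define t where "t = \<delta> * r / p"
    have t1: "1 - t = (1 - \<delta>) * r / q" using scal by (simp add: t_def)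
    have "0 < t" using d r p by (simp add: t_def)
    moreover have "0 < 1 - t" unfolding t1 using d r q by simp
    ultimately have t: "0 < t" "t < 1" by auto
    have integrand: "(N x powr (- \<alpha>) * norm (f x) powr p) powr t
        * (N x powr (\<alpha> * b / p * q) * norm (f x) powr q) powr (1 - t)
        = N x powr (\<alpha> * c / p * r) * norm (f x) powr r" for x
    proof -
      \<comment> \<open>The formula for \<open>c\<close> is exactly what makes the powers of
        \<open>N\<close> match.\<close>
      have e1: "- \<alpha> * t + \<alpha> * b / p * q * (1 - t) = \<alpha> * c / p * r"
        unfolding t1 unfolding t_def cdef using p q by (simp add: field_simps)
      have e2: "p * t + q * (1 - t) = r"
        unfolding t1 unfolding t_def using p q by (simp add: field_simps)
      have "(N x powr (- \<alpha>) * norm (f x) powr p) powr t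
          * (N x powr (\<alpha> * b / p * q) * norm (f x) powr q) powr (1 - t)
          = N x powr (- \<alpha> * t + \<alpha> * b / p * q * (1 - t)) * norm (f x) powr (p * t + q * (1 - t))"
        by (simp only: powr_mult powr_powr powr_add mult_ac)
      then show ?thesis by (simp only: e1 e2)
    qed
    have "J f (\<alpha> * c / p * r) r \<le> J f (- \<alpha>) p powr t * J f (\<alpha> * b / p * q) q powr (1 - t)"
      unfolding J_def integrand[symmetric] using t p q
      by (intro Holder_inequality_powr integrable_weighted_norm_powr) auto
    \<comment> \<open>The power \<open>1 / r\<close> turns the weights \<open>t\<close> and
      \<open>1 - t\<close> into \<open>\<delta> / p\<close> and
      \<open>(1 - \<delta>) / q\<close>.\<close>
    then have "J f (\<alpha> * c / p * r) r powr (1 / r)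
        \<le> (J f (- \<alpha>) p powr t * J f (\<alpha> * b / p * q) q powr (1 - t)) powr (1 / r)"
      using r J_nonneg by (intro powr_mono2) auto
    also have "\<dots> = rpow0 (J f (- \<alpha>) p powr (1 / p)) \<delta> * rpow0 (J f (\<alpha> * b / p * q) q powr (1 / q)) (1 - \<delta>)"
      unfolding t1 unfolding t_def using d r by (simp add: rpow0_def powr_mult powr_powr)
    finally show ?thesis
      unfolding ckn[OF f] mult.assoc using \<open>C0 \<ge> 0\<close> by (intro mult_left_mono)
  qed
  moreover have "\<exists>f. test_fun f \<and> \<not> CKN_ineq P w N p q r \<delta> \<alpha> b c C f"
    if cases: "(q = p \<and> b = -1) \<or> \<delta> = 0 \<or> \<delta> = 1" and C: "C0 < C" for C
  proof -
    obtain f :: "real^'n \<Rightarrow> complex" where f: "test_fun f" "\<And>x. x \<in> box 1 2 \<Longrightarrow> f x \<noteq> 0"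
      using ex_test_fun_pos_on_box by blast
    obtain K where "compact K" "0 \<notin> K" "\<And>x. x \<notin> K \<Longrightarrow> f x = 0"
      using f unfolding test_fun_def by blast
    then interpret dilation_test_fun P w N f K
      using f by unfold_locales (auto simp: test_fun_def)
    define a where "a = \<alpha> * c / p * r"
    have "J f a r \<noteq> 0"
    proof
      assume "J f a r = 0"
      then have "AE x in lborel. N x powr a * norm (f x) powr r = 0"
        unfolding J_def using r
        by (subst (asm) integral_nonneg_eq_0_iff_AE) (auto intro: integrable_weighted_norm_powr)
      moreover have "N x powr a * norm (f x) powr r \<noteq> 0" if "x \<in> box 1 2" for x
      proof -
        have "x \<noteq> 0" using that by (auto simp: mem_box_cart)
        then show ?thesis using f(2)[OF that] N_pos[of x] by simp
      qed
      ultimately have "AE x in lborel. x \<notin> box 1 (2::real^'n)"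
        by (auto elim: eventually_mono)
      then have "emeasure lborel (box 1 (2::real^'n)) = 0"
        by (subst (asm) AE_iff_measurable[of "box 1 2"]) auto
      moreover have "emeasure lborel (box 1 (2::real^'n)) = ennreal (\<Prod>j\<in>Basis. (2 - 1) \<bullet> (j::real^'n))"
        by (rule emeasure_lborel_box) (auto simp: Basis_vec_def inner_axis)
      moreover have "(\<Prod>j\<in>Basis. (2 - 1) \<bullet> (j::real^'n)) = 1"
        by (rule prod.neutral) (auto simp: Basis_vec_def inner_axis)
      ultimately show False by simp
    qed
    then have "0 < J f a r powr (1 / r)" using J_nonneg[of f a r] by simp
    \<comment> \<open>By \<open>end0\<close> the inequality compares \<open>C\<close> and
      \<open>C0\<close> times the same positive number.\<close>
    then have "\<not> CKN_ineq P w N p q r \<delta> \<alpha> b c C f"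
      using C unfolding ckn[OF f(1)] mult.assoc end0[OF cases, of f, symmetric] a_def by simp
    then show ?thesis using f(1) by blast
  qed
  ultimately show ?thesis unfolding C0_def by blast
qed

end
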